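(* Suppose that $L|K$ satisfies (I) or (II). Then the following equality of ideals of $A$ holds: $$H=\mathcal{N}_\sigma .$$
   Context: Let $K$ be a valued field of characteristic $p>0$ with henselian valuation ring $A$, valuation $v_K$, residue field $k$ and value group $\Gamma=v_K(K^\times)$. Let $L=K(\alpha)$ be the Artin–Schreier extension defined by $\alpha^p-\alpha=f$ for some $f\in K^\times$, assumed non-trivial, i.e. $[L:K]=p$. Let $B$ be the integral closure of $A$ in $L$ (a valuation ring, since $A$ is henselian), $v_L$ the valuation on $L$ extending $v_K$, and $l$ the residue field of $L$. The Galois group $\mathrm{Gal}(L|K)$ is cyclic of order $p$, generated by $\sigma:\alpha\mapsto\alpha+1$. Let $N=N_{L|K}$ be the norm map. Let $\mathfrak{A}=\{g\in K^\times \mid$ the solutions of $X^p-X=g$ generate $L$ over $K\}$. $\mathcal{J}_\sigma$ is the ideal of $B$ generated by $\{\sigma(b)/b-1 \mid b\in L^\times\}$; $H$ is the ideal of $A$ generated by $\{1/g \mid g\in\mathfrak{A}\}$; $\mathcal{N}_\sigma$ is the ideal of $A$ generated by the elements of $N(\mathcal{J}_\sigma)$. Conditions: (I) (Defectless) $L|K$ is defectless, i.e. either $v_L(L^\times)/v_K(K^\times)$ has order $p$ and the residue extension $l|k$ is trivial, or $l|k$ has degree $p$ and $L$ has the same value group $\Gamma$ as $K$. (II) (Rank 1) $\Gamma$ is isomorphic to a subgroup of $\mathbb{R}$ as an ordered group. *)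

theory Defs
  imports
    "HOL-Algebra.Algebra"
    "HOL-Algebra.Algebraic_Closure_Type"
    "HOL-Computational_Algebra.Computational_Algebra"
begin

text \<open>
  The large field \<open>L\<close> is a type of class \<open>field\<close>; the base field \<open>K\<close>, its valuation ring \<open>A\<close> and
  the integral closure \<open>B\<close> are subsets of that type.  Elements are handled with the type-class
  operations; ideals, quotient rings, subfields and dimensions are those of HOL-Algebra, reached
  through the library record \<open>ring_of_type_algebra\<close>, whose carrier is the whole type.
\<close>

abbreviation amb :: "'a::field ring" where
  "amb \<equiv> ring_of_type_algebra"

abbreviation ring_on :: "'a::field set \<Rightarrow> 'a ring" where
  "ring_on S \<equiv> amb\<lparr>carrier := S\<rparr>"

text \<open>
  Valuations are written additively.  The value \<open>v 0 = \<infinity>\<close> is represented by never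
  looking at \<open>v\<close> in \<open>0\<close>, and \<open>v\<close> is unconstrained outside its field of definition.
  The value group is the image of the nonzero elements, which may be smaller than the type \<open>'g\<close>.
\<close>

definition valuation_on :: "'a::field set \<Rightarrow> ('a \<Rightarrow> 'g::linordered_ab_group_add) \<Rightarrow> bool" where
  "valuation_on F v \<longleftrightarrow> subfield F amb \<and>
     (\<forall>x\<in>F - {0}. \<forall>y\<in>F - {0}. v (x * y) = v x + v y) \<and>
     (\<forall>x\<in>F - {0}. \<forall>y\<in>F - {0}. x + y \<noteq> 0 \<longrightarrow> min (v x) (v y) \<le> v (x + y))"

definition val_ring :: "'a::field set \<Rightarrow> ('a \<Rightarrow> 'g::linordered_ab_group_add) \<Rightarrow> 'a set" where
  "val_ring F v = {x \<in> F. x = 0 \<or> 0 \<le> v x}"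

definition val_max_ideal :: "'a::field set \<Rightarrow> ('a \<Rightarrow> 'g::linordered_ab_group_add) \<Rightarrow> 'a set" where
  "val_max_ideal F v = {x \<in> F. x = 0 \<or> 0 < v x}"

definition value_group :: "'a::field set \<Rightarrow> ('a \<Rightarrow> 'g::linordered_ab_group_add) \<Rightarrow> 'g monoid" where
  "value_group F v = \<lparr>carrier = v ` (F - {0}), monoid.mult = (+), one = 0\<rparr>"

definition residue_field :: "'a::field set \<Rightarrow> ('a \<Rightarrow> 'g::linordered_ab_group_add) \<Rightarrow> 'a set ring" where
  "residue_field F v = ring_on (val_ring F v) Quot val_max_ideal F v"

text \<open>
  If \<open>w\<close> on the whole type extends \<open>v\<close> on \<open>K\<close>, the residue field of \<open>v\<close> embeds into that of \<open>w\<close>;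
  this is the image of the embedding.
\<close>

definition residue_subfield ::
  "'a::field set \<Rightarrow> ('a \<Rightarrow> 'g::linordered_ab_group_add) \<Rightarrow> ('a \<Rightarrow> 'g) \<Rightarrow> 'a set set" where
  "residue_subfield K v w =
     (\<lambda>a. val_max_ideal UNIV w +>\<^bsub>ring_on (val_ring UNIV w)\<^esub> a) ` val_ring K v"

text \<open>
  Hensel's lemma: a simple root in the residue field of a monic polynomial over the valuation
  ring lifts to a root in the valuation ring.
\<close>

definition henselian :: "'a::field set \<Rightarrow> ('a \<Rightarrow> 'g::linordered_ab_group_add) \<Rightarrow> bool" where
  "henselian F v \<longleftrightarrow>
     (\<forall>(f :: 'a poly) a.
        (\<forall>i. Polynomial.coeff f i \<in> val_ring F v) \<longrightarrow> Polynomial.lead_coeff f = 1 \<longrightarrow>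
        a \<in> val_ring F v \<longrightarrow>
        poly f a \<in> val_max_ideal F v \<longrightarrow> poly (pderiv f) a \<notin> val_max_ideal F v \<longrightarrow>
        (\<exists>b\<in>val_ring F v. poly f b = 0 \<and> b - a \<in> val_max_ideal F v))"

definition int_closure :: "'a::field set \<Rightarrow> 'a set" where
  "int_closure A =
     {x. \<exists>f :: 'a poly. (\<forall>i. Polynomial.coeff f i \<in> A) \<and> Polynomial.lead_coeff f = 1 \<and> poly f x = 0}"

definition gal :: "'a::field set \<Rightarrow> ('a \<Rightarrow> 'a) set" where
  "gal K = {\<tau> \<in> ring_iso amb amb. \<forall>x\<in>K. \<tau> x = x}"

text \<open>The norm of a finite Galois extension; all extensions considered here are such.\<close>

definition field_norm :: "'a::field set \<Rightarrow> 'a \<Rightarrow> 'a" where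
  "field_norm K x = (\<Prod>\<tau>\<in>gal K. \<tau> x)"

text \<open>
  The roots of \<open>X ^ p - X - g\<close> are taken inside \<open>L\<close>.  This loses nothing: any two roots differ by
  an element of the prime field, so either all of them lie in \<open>L\<close> or none does, and in the latter
  case the field generated below is \<open>K\<close>.
\<close>

definition AS_gens :: "nat \<Rightarrow> 'a::field set \<Rightarrow> 'a set" where
  "AS_gens p K = {g \<in> K - {0}. generate_field amb (K \<union> {x. x ^ p - x = g}) = UNIV}"

definition H_ideal :: "nat \<Rightarrow> 'a::field set \<Rightarrow> 'a set \<Rightarrow> 'a set" where
  "H_ideal p K A = Idl\<^bsub>ring_on A\<^esub> {1 / g | g. g \<in> AS_gens p K}"

definition J_ideal :: "'a::field set \<Rightarrow> ('a \<Rightarrow> 'a) \<Rightarrow> 'a set" where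
  "J_ideal A \<sigma> = Idl\<^bsub>ring_on (int_closure A)\<^esub> {\<sigma> b / b - 1 | b. b \<noteq> 0}"

definition N_ideal :: "'a::field set \<Rightarrow> 'a set \<Rightarrow> ('a \<Rightarrow> 'a) \<Rightarrow> 'a set" where
  "N_ideal K A \<sigma> = Idl\<^bsub>ring_on A\<^esub> (field_norm K ` J_ideal A \<sigma>)"

definition defectless ::
  "nat \<Rightarrow> 'a::field set \<Rightarrow> ('a \<Rightarrow> 'g::linordered_ab_group_add) \<Rightarrow> ('a \<Rightarrow> 'g) \<Rightarrow> bool" where
  "defectless p K v w \<longleftrightarrow>
     Coset.order (value_group UNIV w Mod carrier (value_group K v)) = p \<and>
       residue_subfield K v w = carrier (residue_field UNIV w)
   \<or> ring.dimension (residue_field UNIV w) p (residue_subfield K v w)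
         (carrier (residue_field UNIV w)) \<and>
       carrier (value_group UNIV w) = carrier (value_group K v)"

text \<open>
  A strictly increasing homomorphism into the reals is the same as an isomorphism of ordered groups
  onto its image.
\<close>

definition rank_one :: "'a::field set \<Rightarrow> ('a \<Rightarrow> 'g::linordered_ab_group_add) \<Rightarrow> bool" where
  "rank_one F v \<longleftrightarrow>
     (\<exists>\<phi> \<in> hom (value_group F v) \<lparr>carrier = (UNIV :: real set), monoid.mult = (+), one = 0\<rparr>.
        strict_mono_on (carrier (value_group F v)) \<phi>)"

end

theory Submission
  imports Defs
begin

text \<open>
  Let \<open>v\<close> be the valuation of \<open>L\<close>, with valuation ring \<open>B\<close> and maximal ideal \<open>M\<close>, let \<open>N\<close> be the norm,
  and call the elements \<open>y = \<alpha> - c\<close> with \<open>c \<in> K\<close> the shifts of \<open>\<alpha>\<close>.  A shift satisfies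
  \<open>\<sigma> y = y + 1\<close> and \<open>N y = y ^ p - y\<close>.  So every norm \<open>N y\<close> is the constant term of an Artin-Schreier
  equation that generates \<open>L\<close>, and conversely every such constant term is a norm \<open>N y\<close> times a nonzero
  element of the prime field (\<open>norm_shift_mem_AS_gens\<close>, \<open>AS_gens_eq_norm_shift\<close>).

  Since \<open>1 / y = \<sigma> y / y - 1\<close> belongs to \<open>\<J>\<^sub>\<sigma>\<close>, its norm \<open>1 / N y\<close> belongs to \<open>\<N>\<^sub>\<sigma>\<close>, which gives
  \<open>H \<subseteq> \<N>\<^sub>\<sigma>\<close>.  The converse says that the shifts already see all of \<open>\<J>\<^sub>\<sigma>\<close>: every \<open>\<sigma> b / b - 1\<close> lies in
  \<open>(1 / y) B\<close> for some shift \<open>y\<close> (\<open>exists_shift_bounding_difference\<close>).  The fractional ideals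
  \<open>(1 / y) B\<close> form a chain, so their union is an ideal; it contains \<open>\<J>\<^sub>\<sigma>\<close>, and \<open>x y \<in> B\<close> gives
  \<open>N x = N (x y) \<cdot> 1 / N y \<in> H\<close>.

  To bound \<open>\<sigma> b / b - 1\<close>, write \<open>b = P \<alpha>\<close> with \<open>P\<close> over \<open>K\<close> of degree less than \<open>p\<close>, and let \<open>P\<^sub>j\<close> be the
  coefficients of \<open>P\<close> at \<open>\<alpha>\<close>, so that \<open>P (\<alpha> + X) = \<Sum>\<^sub>j P\<^sub>j X ^ j\<close>.  Then \<open>\<sigma> b - b = P (\<alpha> + 1) - P \<alpha>\<close> is
  the sum of the \<open>P\<^sub>j\<close> with \<open>j \<ge> 1\<close>.  If \<open>v (P \<alpha>) \<le> v (P\<^sub>j y ^ j)\<close> for all \<open>j\<close>, then every \<open>P\<^sub>j y / b\<close> with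
  \<open>j \<ge> 1\<close> is integral because \<open>v y \<le> 0\<close>, and the bound follows.  If some shift has value 0, the bound is
  trivial.  Otherwise all shifts have negative value, and induction on the degree shows that every
  polynomial of degree less than \<open>p\<close> is dominated in this sense at some shift, and then at all shifts
  of larger value (\<open>exists_taylor_dominated\<close>).

  The induction step (\<open>taylor_dominated_step\<close>) is where the degree \<open>p\<close> enters.  Let \<open>P\<close> have degree \<open>d\<close>
  with \<open>2 \<le> d < p\<close>, and suppose that it is not dominated at a shift \<open>y\<close> at which its derivative is.  Then,
  up to a constant, \<open>P (\<alpha> + y X)\<close> is an integral polynomial with a simple root 0 modulo \<open>M\<close>.  Divide with
  remainder, \<open>X ^ p - X - f = P S + R\<close>.  If \<open>R\<close> is dominated at \<open>y\<close> as well, then substituting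
  \<open>\<alpha> + y X\<close> turns this into a congruence modulo \<open>M\<close> between \<open>P S\<close>, suitably scaled, and a multiple of
  \<open>X ^ p\<close>: the left side becomes \<open>y ^ p X ^ p - y X\<close>, whose last term is negligible as \<open>v y < 0\<close>.  The
  factor \<open>P\<close> contributes only one zero at 0, so \<open>X ^ (p - 1)\<close> divides \<open>S\<close> modulo \<open>M\<close>.  But \<open>S\<close> has
  degree \<open>p - d \<le> p - 2\<close>.

  Hensel's lemma enters through the invariance \<open>v (\<sigma> z) = v z\<close> (\<open>henselian_imp_v_sigma\<close>).  If it failed,
  there would be an \<open>x\<close> with \<open>x \<equiv> 1\<close> modulo \<open>M\<close> and all other conjugates of \<open>x\<close> in \<open>M\<close>.  Its
  characteristic polynomial over \<open>K\<close> is \<open>X ^ (p - 1) (X - 1)\<close> modulo \<open>M\<close>, and the simple root 1 would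
  lift to \<open>K\<close>, forcing \<open>x \<in> K\<close>.
\<close>

section \<open>Polynomials over a subring of a field\<close>

definition poly_over :: "'a::field set \<Rightarrow> 'a poly set" where
  "poly_over S = {P. \<forall>i. Polynomial.coeff P i \<in> S}"

locale unital_subring =
  fixes S :: "'a::field set"
  assumes zero_mem: "0 \<in> S" and one_mem: "1 \<in> S"
    and add_mem: "x \<in> S \<Longrightarrow> y \<in> S \<Longrightarrow> x + y \<in> S"
    and uminus_mem: "x \<in> S \<Longrightarrow> - x \<in> S"
    and mult_mem: "x \<in> S \<Longrightarrow> y \<in> S \<Longrightarrow> x * y \<in> S"
begin

lemma diff_mem: "x \<in> S \<Longrightarrow> y \<in> S \<Longrightarrow> x - y \<in> S"
  using add_mem[of x "- y"] uminus_mem[of y] by simp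

lemma of_nat_mem: "of_nat n \<in> S"
  by (induction n) (auto intro: zero_mem one_mem add_mem)

lemma power_mem: "x \<in> S \<Longrightarrow> x ^ n \<in> S"
  by (induction n) (auto intro: one_mem mult_mem)

lemma sum_mem: "(\<And>i. i \<in> I \<Longrightarrow> g i \<in> S) \<Longrightarrow> sum g I \<in> S"
  by (induction I rule: infinite_finite_induct) (auto intro: zero_mem add_mem)

lemma prod_mem: "(\<And>i. i \<in> I \<Longrightarrow> g i \<in> S) \<Longrightarrow> prod g I \<in> S"
  by (induction I rule: infinite_finite_induct) (auto intro: one_mem mult_mem)

lemmas mem_intros = zero_mem one_mem add_mem uminus_mem mult_mem diff_mem of_nat_mem power_mem

lemma poly_over_0: "0 \<in> poly_over S"
  by (simp add: poly_over_def zero_mem)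

lemma poly_over_pCons: "c \<in> S \<Longrightarrow> P \<in> poly_over S \<Longrightarrow> pCons c P \<in> poly_over S"
  by (auto simp: poly_over_def coeff_pCons split: nat.split)

lemma poly_over_monom: "c \<in> S \<Longrightarrow> Polynomial.monom c n \<in> poly_over S"
  by (auto simp: poly_over_def zero_mem)

lemma poly_over_add: "P \<in> poly_over S \<Longrightarrow> Q \<in> poly_over S \<Longrightarrow> P + Q \<in> poly_over S"
  by (simp add: poly_over_def add_mem)

lemma poly_over_diff: "P \<in> poly_over S \<Longrightarrow> Q \<in> poly_over S \<Longrightarrow> P - Q \<in> poly_over S"
  by (simp add: poly_over_def diff_mem)

lemma poly_over_smult: "c \<in> S \<Longrightarrow> P \<in> poly_over S \<Longrightarrow> Polynomial.smult c P \<in> poly_over S"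
  by (simp add: poly_over_def mult_mem)

lemma poly_over_mult: "P \<in> poly_over S \<Longrightarrow> Q \<in> poly_over S \<Longrightarrow> P * Q \<in> poly_over S"
  by (auto simp: poly_over_def coeff_mult intro!: sum_mem mult_mem)

lemma poly_over_prod: "(\<And>i. i \<in> I \<Longrightarrow> P i \<in> poly_over S) \<Longrightarrow> prod P I \<in> poly_over S"
  by (induction I rule: infinite_finite_induct)
     (auto intro: poly_over_mult poly_over_pCons poly_over_0 simp: one_pCons one_mem)

lemma poly_over_pderiv: "P \<in> poly_over S \<Longrightarrow> pderiv P \<in> poly_over S"
  using of_nat_mem by (auto simp: poly_over_def coeff_pderiv simp flip: of_nat_Suc intro!: mult_mem)

lemma poly_mem: "P \<in> poly_over S \<Longrightarrow> x \<in> S \<Longrightarrow> poly P x \<in> S"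
  by (auto simp: poly_over_def poly_altdef intro!: sum_mem mult_mem power_mem)

end

text \<open>
  The divisor is monic, so division with remainder never leaves the subring.
\<close>
lemma poly_over_mod:
  fixes F :: "'a::field poly"
  assumes "unital_subring T" "F \<in> poly_over T" "P \<in> poly_over T" "Polynomial.lead_coeff P = 1"
  shows "F mod P \<in> poly_over T"
  using assms(2)
proof (induction "Polynomial.degree F" arbitrary: F rule: less_induct)
  case less
  interpret T: unital_subring T by fact
  show ?case
  proof (cases "F = 0 \<or> Polynomial.degree F < Polynomial.degree P")
    case True
    then show ?thesis using less.prems by (auto simp: mod_poly_less)
  next
    case False
    define n where "n = Polynomial.degree F - Polynomial.degree P"
    define Q where "Q = Polynomial.monom (Polynomial.lead_coeff F) n * P"
    have P0: "P \<noteq> 0" using assms(4) by auto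
    have lF: "Polynomial.lead_coeff F \<noteq> 0" using False by auto
    then have dm: "Polynomial.degree (Polynomial.monom (Polynomial.lead_coeff F) n) = n"
      by (rule Polynomial.degree_monom_eq)
    have "Polynomial.degree Q = n + Polynomial.degree P"
      unfolding Q_def using P0 lF dm
      by (metis Polynomial.degree_mult_eq Polynomial.monom_eq_0_iff)
    then have dQ: "Polynomial.degree Q = Polynomial.degree F"
      using False by (simp add: n_def)
    have lQ: "Polynomial.lead_coeff Q = Polynomial.lead_coeff F"
      using dm assms(4) by (simp add: Q_def Polynomial.lead_coeff_mult)
    have Qo: "Q \<in> poly_over T"
      unfolding Q_def using less.prems assms(3)
      by (intro T.poly_over_mult T.poly_over_monom) (auto simp: poly_over_def)
    have red: "(F - Q) mod P = F mod P"
      by (simp add: Q_def mod_diff_eq[symmetric] poly_mod_diff_left)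
    show ?thesis
    proof (cases "F = Q")
      case True
      then show ?thesis using red T.poly_over_0 by simp
    next
      case neq: False
      show ?thesis
      proof (cases "Polynomial.degree F = 0")
        case True
        then have "F = Q" using dQ lQ by (metis Polynomial.degree_eq_zeroE coeff_pCons_0)
        with neq show ?thesis by simp
      next
        case dF: False
        have "Polynomial.degree (F - Q) < Polynomial.degree F"
          using dF dQ lQ neq by (intro Polynomial.degree_less_if_less_eqI)
             (auto simp: Polynomial.degree_diff_le)
        then have "(F - Q) mod P \<in> poly_over T"
          by (rule less.hyps) (intro T.poly_over_diff less.prems Qo)
        then show ?thesis using red by simp
      qed
    qed
  qed
qed

section \<open>Subfields and generated subfields of the ambient field\<close>

lemma amb_simps [simp]:
  "carrier amb = UNIV" "x \<otimes>\<^bsub>amb\<^esub> y = x * y" "x \<oplus>\<^bsub>amb\<^esub> y = x + y"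
  "\<one>\<^bsub>amb\<^esub> = 1" "\<zero>\<^bsub>amb\<^esub> = 0"
  by (simp_all add: ring_of_type_algebra_def)

lemma amb_uminus [simp]: "\<ominus>\<^bsub>amb\<^esub> x = - (x::'a::field)"
proof -
  interpret cring "amb :: 'a ring" by (rule cring_from_type_algebra)
  show ?thesis by (rule minus_equality) auto
qed

lemma amb_inv [simp]:
  assumes "x \<noteq> 0"
  shows "inv\<^bsub>amb\<^esub> x = inverse (x::'a::field)"
proof -
  interpret cring "amb :: 'a ring" by (rule cring_from_type_algebra)
  show ?thesis using assms by (intro comm_inv_char) auto
qed

lemma subfield_amb_iff:
  fixes F :: "'a::field set"
  shows "subfield F amb \<longleftrightarrow> unital_subring F \<and> (\<forall>x\<in>F. inverse x \<in> F)"
proof -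
  interpret R: field "amb :: 'a ring" by (rule field_from_type_algebra)
  show ?thesis
  proof
    assume F: "subfield F amb"
    note r = subringE[OF subfieldE(1)[OF F], simplified]
    have u: "unital_subring F" by standard (use r in auto)
    have "inverse x \<in> F" if "x \<in> F" for x
      using R.subfield_m_inv(1)[OF F, of x] that r(2) by (cases "x = 0") auto
    with u show "unital_subring F \<and> (\<forall>x\<in>F. inverse x \<in> F)" by blast
  next
    assume *: "unital_subring F \<and> (\<forall>x\<in>F. inverse x \<in> F)"
    then interpret unital_subring F by blast
    show "subfield F amb"
      by (rule R.subfieldI', rule R.subringI) (use * in \<open>auto intro: mem_intros\<close>)
  qed
qed

lemma generate_field_amb_subset:
  fixes F :: "'a::field set"
  assumes "subfield F amb" "Z \<subseteq> F"
  shows "generate_field amb Z \<subseteq> F"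
proof -
  interpret R: field "amb :: 'a ring" by (rule field_from_type_algebra)
  show ?thesis by (rule R.generate_field_min_subfield1) (use assms in auto)
qed

lemma generate_field_amb_subfield: "subfield (generate_field amb Z) (amb :: 'a::field ring)"
proof -
  interpret R: field "amb :: 'a ring" by (rule field_from_type_algebra)
  show ?thesis by (rule R.generate_field_is_subfield) auto
qed

lemma prod_cyclic_shift:
  fixes h :: "nat \<Rightarrow> 'b::comm_monoid_mult"
  assumes "h n = h 0"
  shows "(\<Prod>i<n. h (Suc i)) = (\<Prod>i<n. h i)"
proof (cases n)
  case (Suc m)
  then show ?thesis
    using assms prod.lessThan_Suc_shift[of h m] by (simp add: mult.commute)
qed simp

lemma sum_cyclic_shift:
  fixes h :: "nat \<Rightarrow> 'b::comm_monoid_add"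
  assumes "h n = h 0"
  shows "(\<Sum>i<n. h (Suc i)) = (\<Sum>i<n. h i)"
proof (cases n)
  case (Suc m)
  then show ?thesis
    using assms sum.lessThan_Suc_shift[of h m] by (simp add: add.commute)
qed simp

section \<open>Artin-Schreier extensions and their Galois group\<close>

locale artin_schreier =
  fixes p :: nat and K :: "'a::field set" and \<sigma> :: "'a \<Rightarrow> 'a" and \<alpha> :: 'a
  assumes p_pos: "p > 0" and char: "CHAR('a) = p"
    and subfield_K: "subfield K amb"
    and generates: "generate_field amb (K \<union> {\<alpha>}) = UNIV"
    and AS_mem: "\<alpha> ^ p - \<alpha> \<in> K"
    and sigma_gal: "\<sigma> \<in> gal K" and sigma_alpha: "\<sigma> \<alpha> = \<alpha> + 1"
begin

sublocale K: unital_subring K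
  using subfield_K by (simp add: subfield_amb_iff)

lemma K_inverse: "x \<in> K \<Longrightarrow> inverse x \<in> K"
  using subfield_K by (simp add: subfield_amb_iff)

lemma K_divide: "x \<in> K \<Longrightarrow> y \<in> K \<Longrightarrow> x / y \<in> K"
  by (simp add: divide_inverse K_inverse K.mult_mem)

lemma prime_p: "Factorial_Ring.prime p"
  using prime_CHAR_semidom[where ?'a = 'a] p_pos char by simp

lemma p_gt_1: "p > 1"
  using prime_p by (rule prime_gt_1_nat)

lemma of_nat_p [simp]: "of_nat p = (0::'a)"
  using of_nat_CHAR[where ?'a = 'a] char by simp

lemma of_nat_eq_0: "(of_nat i = (0::'a)) \<longleftrightarrow> p dvd i"
  by (simp add: of_nat_eq_0_iff_char_dvd char)

lemma inj_of_nat: "inj_on (of_nat :: nat \<Rightarrow> 'a) {..<p}"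
proof -
  have "i = j" if "i \<le> j" "j < p" "of_nat i = (of_nat j :: 'a)" for i j
  proof -
    have "of_nat (j - i) = (0 :: 'a)" using that by (simp add: of_nat_diff)
    then have "p dvd j - i" by (simp add: of_nat_eq_0)
    then show "i = j" using that by (auto dest: dvd_imp_le)
  qed
  then show ?thesis by (metis inj_onI lessThan_iff nle_le)
qed

lemma frobenius_add: "(x + y) ^ p = x ^ p + (y::'a) ^ p"
  using prime_p char by (intro freshmans_dream) auto

lemma frobenius_diff: "(x - y) ^ p = x ^ p - (y::'a) ^ p"
  using frobenius_add[of "x - y" y] by (simp add: algebra_simps)

lemma of_nat_power_p: "of_nat i ^ p = (of_nat i :: 'a)"
  by (induction i) (use p_pos in \<open>simp_all add: frobenius_add\<close>)

text \<open>
  Both sides are monic of degree \<open>p\<close> in \<open>y\<close> and vanish at the \<open>p\<close> elements of the prime field.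
\<close>
lemma prod_add_of_nat: "(\<Prod>i<p. y + of_nat i) = y ^ p - (y::'a)"
proof -
  define P where "P = (\<Prod>i<p. [:of_nat i, 1 :: 'a:])"
  define Q where "Q = Polynomial.monom 1 p - [:0, 1 :: 'a:]"
  have dP: "Polynomial.degree P = p"
    by (simp add: P_def Polynomial.degree_prod_sum_eq)
  have lP: "Polynomial.lead_coeff P = 1"
    unfolding P_def by (subst Polynomial.lead_coeff_prod) simp
  have cQ: "Polynomial.coeff Q p = 1"
    using p_gt_1 by (simp add: Q_def coeff_pCons split: nat.split)
  have dQ: "Polynomial.degree Q = p"
    using p_gt_1 cQ unfolding Q_def
    by (intro antisym Polynomial.degree_diff_le Polynomial.le_degree)
       (auto simp: Polynomial.degree_monom_le)
  define Z where "Z = (\<lambda>i. - (of_nat i :: 'a)) ` {..<p}"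
  have "card Z = p"
    unfolding Z_def using inj_of_nat by (subst card_image) (auto simp: inj_on_def)
  moreover have "poly P x = poly Q x" if "x \<in> Z" for x
  proof -
    from that obtain i where i: "i < p" "x = - of_nat i" by (auto simp: Z_def)
    have "poly P x = 0"
      using i by (auto simp: P_def poly_prod intro!: prod_zero bexI[of _ i])
    moreover have "poly Q x = 0"
      using i minus_power_prime_CHAR[OF char[symmetric] prime_p, of "of_nat i"]
      by (simp add: Q_def Polynomial.poly_monom of_nat_power_p)
    ultimately show ?thesis by simp
  qed
  ultimately have "P = Q"
    using dP dQ lP cQ
    by (intro Polynomial.poly_eqI_degree_lead_coeff[of P p Q Z]) auto
  then have "poly P y = poly Q y" by simp
  then show ?thesis
    by (simp add: P_def Q_def poly_prod Polynomial.poly_monom add.commute)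
qed

lemma power_p_eq_self: "y ^ p = (y::'a) \<Longrightarrow> \<exists>i<p. y = of_nat i"
proof -
  assume "y ^ p = y"
  then have "(- y) ^ p - (- y) = 0"
    using minus_power_prime_CHAR[OF char[symmetric] prime_p, of y] by simp
  then have "(\<Prod>i<p. - y + of_nat i) = 0" by (simp only: prod_add_of_nat)
  then show ?thesis by (auto simp: prod_zero_iff)
qed

lemma sigma_add: "\<sigma> (x + y) = \<sigma> x + \<sigma> y"
  and sigma_mult: "\<sigma> (x * y) = \<sigma> x * \<sigma> y"
  and sigma_1 [simp]: "\<sigma> 1 = 1"
  and sigma_fix: "x \<in> K \<Longrightarrow> \<sigma> x = x"
  and sigma_inj: "inj \<sigma>"
  using sigma_gal by (auto simp: gal_def ring_iso_def ring_hom_def bij_betw_def)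

lemma sigma_0 [simp]: "\<sigma> 0 = 0"
  by (rule sigma_fix) (rule K.zero_mem)

lemma sigma_eq_0 [simp]: "\<sigma> x = 0 \<longleftrightarrow> x = 0"
  using injD[OF sigma_inj, of x 0] by auto

lemma sigma_pow_add: "(\<sigma> ^^ n) (x + y) = (\<sigma> ^^ n) x + (\<sigma> ^^ n) y"
  by (induction n) (auto simp: sigma_add)

lemma sigma_pow_mult: "(\<sigma> ^^ n) (x * y) = (\<sigma> ^^ n) x * (\<sigma> ^^ n) y"
  by (induction n) (auto simp: sigma_mult)

lemma sigma_pow_fix: "x \<in> K \<Longrightarrow> (\<sigma> ^^ n) x = x"
  by (induction n) (auto simp: sigma_fix)

lemma sigma_pow_0 [simp]: "(\<sigma> ^^ n) 0 = 0"
  by (induction n) auto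

lemma sigma_pow_eq_0 [simp]: "(\<sigma> ^^ n) x = 0 \<longleftrightarrow> x = 0"
  by (induction n) auto

lemma sigma_pow_alpha: "(\<sigma> ^^ n) \<alpha> = \<alpha> + of_nat n"
  by (induction n) (auto simp: sigma_add sigma_alpha sigma_fix K.of_nat_mem)

lemma sigma_sum: "\<sigma> (sum g I) = (\<Sum>i\<in>I. \<sigma> (g i))"
  by (induction I rule: infinite_finite_induct) (auto simp: sigma_add)

lemma sigma_prod: "\<sigma> (prod g I) = (\<Prod>i\<in>I. \<sigma> (g i))"
  by (induction I rule: infinite_finite_induct) (auto simp: sigma_mult)

lemma sigma_pow_prod: "(\<sigma> ^^ n) (prod g I) = (\<Prod>i\<in>I. (\<sigma> ^^ n) (g i))"
  by (induction n) (auto simp: sigma_prod)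

lemma sigma_power: "\<sigma> (x ^ n) = \<sigma> x ^ n"
  by (induction n) (auto simp: sigma_mult)

lemma sigma_poly: "P \<in> poly_over K \<Longrightarrow> \<sigma> (poly P x) = poly P (\<sigma> x)"
  by (simp add: poly_altdef sigma_sum sigma_mult sigma_power sigma_fix poly_over_def)

lemma sigma_pow_poly: "P \<in> poly_over K \<Longrightarrow> (\<sigma> ^^ n) (poly P \<alpha>) = poly P (\<alpha> + of_nat n)"
  by (induction n) (auto simp: sigma_poly sigma_add sigma_alpha sigma_fix K.of_nat_mem add_ac)

text \<open>
  The \<open>p\<close> conjugates \<open>\<alpha> + n\<close> of \<open>\<alpha>\<close> are too many arguments for a polynomial of degree less than \<open>p\<close> to
  take one value at all of them.  This is how \<open>\<alpha>\<close> is seen to have degree \<open>p\<close> over \<open>K\<close> and \<open>K\<close> to be the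
  fixed field of \<open>\<sigma>\<close>.
\<close>
lemma constant_on_conjugates:
  assumes P: "Polynomial.degree P < p" and c: "\<And>n. n < p \<Longrightarrow> poly P (\<alpha> + of_nat n) = c"
  shows "P = [:c:]"
proof (rule Polynomial.poly_eqI_degree[of "(\<lambda>n. \<alpha> + of_nat n) ` {..<p}"])
  have "card ((\<lambda>n. \<alpha> + of_nat n) ` {..<p}) = p"
    using inj_of_nat by (subst card_image) (auto simp: inj_on_def)
  then show "Polynomial.degree P < card ((\<lambda>n. \<alpha> + of_nat n) ` {..<p})"
    "Polynomial.degree [:c:] < card ((\<lambda>n. \<alpha> + of_nat n) ` {..<p})"
    using P p_pos by auto
qed (use c in auto)

lemma poly_alpha_nonzero:
  assumes "P \<in> poly_over K" "Polynomial.degree P < p" "P \<noteq> 0"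
  shows "poly P \<alpha> \<noteq> 0"
proof
  assume "poly P \<alpha> = 0"
  then have "poly P (\<alpha> + of_nat n) = 0" for n
    using sigma_pow_poly[OF assms(1), of n] by simp
  then have "P = [:0:]" using constant_on_conjugates[OF assms(2)] by simp
  with assms(3) show False by simp
qed

definition AS_poly :: "'a poly" where
  "AS_poly = Polynomial.monom 1 p - [:\<alpha> ^ p - \<alpha>, 1:]"

lemma AS_poly_over: "AS_poly \<in> poly_over K"
  unfolding AS_poly_def
  by (intro K.poly_over_diff K.poly_over_monom K.poly_over_pCons AS_mem K.poly_over_0 K.one_mem)

lemma coeff_AS_poly: "Polynomial.coeff AS_poly p = 1"
  using p_gt_1 by (simp add: AS_poly_def coeff_pCons split: nat.split)

lemma degree_AS_poly: "Polynomial.degree AS_poly = p"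
  using p_gt_1 coeff_AS_poly unfolding AS_poly_def
  by (intro antisym Polynomial.degree_diff_le Polynomial.le_degree)
     (auto simp: Polynomial.degree_monom_le)

lemma poly_AS_poly: "poly AS_poly \<alpha> = 0"
  by (simp add: AS_poly_def Polynomial.poly_monom)

lemma reduce_degree:
  assumes "P \<in> poly_over K"
  obtains Q where "Q \<in> poly_over K" "Polynomial.degree Q < p" "poly Q \<alpha> = poly P \<alpha>"
proof
  show "P mod AS_poly \<in> poly_over K"
    by (rule poly_over_mod[OF _ assms AS_poly_over]) (auto simp: degree_AS_poly coeff_AS_poly K.unital_subring_axioms)
  have "AS_poly \<noteq> 0" using degree_AS_poly p_pos by auto
  then show "Polynomial.degree (P mod AS_poly) < p"
    using Polynomial.degree_mod_less[of AS_poly P] degree_AS_poly p_pos by auto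
  have "poly P \<alpha> = poly (P div AS_poly * AS_poly + P mod AS_poly) \<alpha>"
    by (simp only: div_mult_mod_eq)
  then show "poly (P mod AS_poly) \<alpha> = poly P \<alpha>"
    by (simp only: poly_add poly_mult poly_AS_poly) simp
qed

text \<open>
  This covers only elements of \<open>K[\<alpha>]\<close>, since it serves to prove that \<open>K[\<alpha>]\<close> is all of \<open>L\<close>.
\<close>
lemma fixed_poly_mem:
  assumes "P \<in> poly_over K" "\<sigma> (poly P \<alpha>) = poly P \<alpha>"
  shows "poly P \<alpha> \<in> K"
proof -
  from assms(1) obtain Q where Q: "Q \<in> poly_over K" "Polynomial.degree Q < p" "poly Q \<alpha> = poly P \<alpha>"
    by (rule reduce_degree)
  have "(\<sigma> ^^ n) (poly Q \<alpha>) = poly P \<alpha>" for n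
    using assms(2) Q(3) by (induction n) auto
  then have "Q = [:poly P \<alpha>:]"
    using constant_on_conjugates[OF Q(2)] sigma_pow_poly[OF Q(1)] by simp
  then have "Polynomial.coeff Q 0 = poly P \<alpha>" by simp
  moreover have "Polynomial.coeff Q 0 \<in> K" using Q(1) by (simp add: poly_over_def)
  ultimately show ?thesis by simp
qed

lemma sigma_norm_prod:
  assumes "(\<sigma> ^^ p) x = x"
  shows "\<sigma> (\<Prod>i<p. (\<sigma> ^^ i) x) = (\<Prod>i<p. (\<sigma> ^^ i) x)"
  using prod_cyclic_shift[of "\<lambda>i. (\<sigma> ^^ i) x" p] assms by (simp add: sigma_prod)

text \<open>
  The ring \<open>K[\<alpha>]\<close> is a field: the product of the conjugates of \<open>x\<close> other than \<open>x\<close> itself is again in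
  \<open>K[\<alpha>]\<close>, and multiplied by \<open>x\<close> it gives a nonzero element fixed by \<open>\<sigma>\<close>, which lies in \<open>K\<close>.
\<close>
lemma poly_representation:
  obtains P where "P \<in> poly_over K" "Polynomial.degree P < p" "x = poly P \<alpha>"
proof -
  define E where "E = (\<lambda>P. poly P \<alpha>) ` poly_over K"
  have KE: "c \<in> E" if "c \<in> K" for c
    unfolding E_def using that
    by (intro image_eqI[of _ _ "[:c:]"]) (auto intro: K.poly_over_pCons K.poly_over_0)
  interpret E: unital_subring E
  proof
    show "0 \<in> E" "1 \<in> E" by (auto intro: KE K.mem_intros)
    fix x assume "x \<in> E"
    then obtain P where P: "P \<in> poly_over K" "x = poly P \<alpha>" by (auto simp: E_def)
    then have "- x = poly (0 - P) \<alpha>" by simp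
    with P(1) show "- x \<in> E" unfolding E_def by (blast intro: K.poly_over_diff K.poly_over_0)
    fix y assume "y \<in> E"
    then obtain Q where Q: "Q \<in> poly_over K" "y = poly Q \<alpha>" by (auto simp: E_def)
    have "x + y = poly (P + Q) \<alpha>" "x * y = poly (P * Q) \<alpha>" using P Q by auto
    with P(1) Q(1) show "x + y \<in> E" "x * y \<in> E"
      unfolding E_def by (blast intro: K.poly_over_add K.poly_over_mult)+
  qed
  have sE: "(\<sigma> ^^ n) x \<in> E" if "x \<in> E" for x n
  proof -
    from that obtain P where P: "P \<in> poly_over K" "x = poly P \<alpha>" by (auto simp: E_def)
    have "\<alpha> + of_nat n \<in> E"
      by (intro E.add_mem E.of_nat_mem)
         (auto simp: E_def intro!: image_eqI[of _ _ "[:0,1:]"] K.poly_over_pCons K.poly_over_0 K.mem_intros)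
    moreover have "P \<in> poly_over E" using P(1) KE by (auto simp: poly_over_def)
    ultimately show ?thesis using P by (simp add: sigma_pow_poly E.poly_mem)
  qed
  have invE: "inverse x \<in> E" if x: "x \<in> E" for x
  proof (cases "x = 0")
    case False
    define n where "n = (\<Prod>i<p. (\<sigma> ^^ i) x)"
    define y where "y = (\<Prod>i\<in>{1..<p}. (\<sigma> ^^ i) x)"
    have nxy: "n = x * y"
      unfolding n_def y_def lessThan_atLeast0 using p_pos by (simp add: prod.atLeast_Suc_lessThan)
    have yE: "y \<in> E" unfolding y_def by (intro E.prod_mem sE x)
    from x obtain P where P: "P \<in> poly_over K" "x = poly P \<alpha>" by (auto simp: E_def)
    have "(\<sigma> ^^ p) x = x" using sigma_pow_poly[OF P(1), of p] P(2) by simp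
    then have "\<sigma> n = n" unfolding n_def by (rule sigma_norm_prod)
    moreover have "n \<in> E" unfolding nxy by (intro E.mult_mem x yE)
    ultimately have "n \<in> K" using fixed_poly_mem by (auto simp: E_def)
    moreover have "n \<noteq> 0" using False by (simp add: n_def)
    moreover have "inverse x = y * inverse n" using \<open>n \<noteq> 0\<close> by (auto simp: nxy field_simps)
    ultimately show ?thesis using yE KE K_inverse E.mult_mem by metis
  qed (simp add: E.zero_mem)
  have "subfield E amb" using invE E.unital_subring_axioms by (simp add: subfield_amb_iff)
  moreover have "\<alpha> \<in> E"
    by (auto simp: E_def intro!: image_eqI[of _ _ "[:0,1:]"] K.poly_over_pCons K.poly_over_0 K.mem_intros)
  ultimately have "generate_field amb (K \<union> {\<alpha>}) \<subseteq> E"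
    using KE by (intro generate_field_amb_subset) auto
  with generates have "x \<in> E" by auto
  then obtain P where "P \<in> poly_over K" "x = poly P \<alpha>" by (auto simp: E_def)
  then show thesis using reduce_degree[of P] that by metis
qed

lemma fixed_mem: "\<sigma> x = x \<Longrightarrow> x \<in> K"
  by (metis fixed_poly_mem poly_representation)

lemma alpha_not_mem: "\<alpha> \<notin> K"
  using sigma_fix[of \<alpha>] sigma_alpha by auto

lemma sigma_pow_p: "(\<sigma> ^^ p) x = x"
proof -
  obtain P where "P \<in> poly_over K" "x = poly P \<alpha>" by (rule poly_representation)
  then show ?thesis using sigma_pow_poly[of P p] by simp
qed

text \<open>
  An automorphism over \<open>K\<close> sends \<open>\<alpha>\<close> to another root of \<open>X ^ p - X - f\<close>, that is to some \<open>\<alpha> + i\<close>, and it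
  is determined by that root.
\<close>
lemma gal_eq: "gal K = (\<lambda>i. \<sigma> ^^ i) ` {..<p}"
proof (intro equalityI subsetI)
  fix \<tau> assume \<tau>: "\<tau> \<in> gal K"
  then have hom: "\<tau> (x + y) = \<tau> x + \<tau> y" "\<tau> (x * y) = \<tau> x * \<tau> y" "\<tau> 1 = 1" "x \<in> K \<Longrightarrow> \<tau> x = x" for x y
    by (auto simp: gal_def ring_iso_def ring_hom_def)
  have pow: "\<tau> (x ^ n) = \<tau> x ^ n" for x n
    by (induction n) (auto simp: hom)
  have \<tau>0: "\<tau> 0 = 0" by (rule hom(4)) (rule K.zero_mem)
  have sum: "\<tau> (sum g I) = (\<Sum>i\<in>I. \<tau> (g i))" for g and I :: "nat set"
    by (induction I rule: infinite_finite_induct) (auto simp: hom \<tau>0)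
  have "\<tau> (\<alpha> ^ p) = \<tau> (\<alpha> + (\<alpha> ^ p - \<alpha>))" by simp
  also have "\<dots> = \<tau> \<alpha> + (\<alpha> ^ p - \<alpha>)" using hom(1,4) AS_mem by metis
  finally have "\<tau> \<alpha> ^ p - \<tau> \<alpha> = \<alpha> ^ p - \<alpha>" by (simp add: pow)
  then have "(\<tau> \<alpha> - \<alpha>) ^ p = \<tau> \<alpha> - \<alpha>" by (simp add: frobenius_diff algebra_simps)
  then obtain i where i: "i < p" "\<tau> \<alpha> - \<alpha> = of_nat i" using power_p_eq_self by blast
  have "\<tau> x = (\<sigma> ^^ i) x" for x
  proof -
    obtain P where P: "P \<in> poly_over K" "x = poly P \<alpha>" by (rule poly_representation)
    have "\<tau> x = poly P (\<tau> \<alpha>)"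
      using P by (simp add: poly_altdef sum hom pow poly_over_def)
    also have "\<tau> \<alpha> = \<alpha> + of_nat i" using i(2) by (simp add: algebra_simps)
    finally show ?thesis using P sigma_pow_poly by simp
  qed
  then show "\<tau> \<in> (\<lambda>i. \<sigma> ^^ i) ` {..<p}" using i(1) by auto
next
  fix \<tau> assume "\<tau> \<in> (\<lambda>i. \<sigma> ^^ i) ` {..<p}"
  then obtain i where i: "i < p" "\<tau> = \<sigma> ^^ i" by blast
  have "bij (\<sigma> ^^ i)"
    using sigma_gal by (intro bij_betw_funpow) (auto simp: gal_def ring_iso_def)
  moreover have "(\<sigma> ^^ i) 1 = 1" by (rule sigma_pow_fix) (rule K.one_mem)
  ultimately show "\<tau> \<in> gal K"
    unfolding i(2) by (auto simp: gal_def ring_iso_def ring_hom_def sigma_pow_add sigma_pow_mult sigma_pow_fix)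
qed

lemma field_norm_eq: "field_norm K x = (\<Prod>i<p. (\<sigma> ^^ i) x)"
proof -
  have "inj_on (\<lambda>i. \<sigma> ^^ i) {..<p}"
  proof (rule inj_onI)
    fix i j assume *: "i \<in> {..<p}" "j \<in> {..<p}" "\<sigma> ^^ i = \<sigma> ^^ j"
    then have "(\<sigma> ^^ i) \<alpha> = (\<sigma> ^^ j) \<alpha>" by simp
    then have "of_nat i = (of_nat j :: 'a)" by (simp add: sigma_pow_alpha)
    then show "i = j" using * inj_onD[OF inj_of_nat] by blast
  qed
  then show ?thesis unfolding field_norm_def gal_eq by (simp add: prod.reindex)
qed

lemma norm_mult: "field_norm K (x * y) = field_norm K x * field_norm K y"
  by (simp add: field_norm_eq sigma_pow_mult prod.distrib)

lemma norm_mem: "field_norm K x \<in> K"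
  unfolding field_norm_eq by (intro fixed_mem sigma_norm_prod sigma_pow_p)

lemma norm_eq_0 [simp]: "field_norm K x = 0 \<longleftrightarrow> x = 0"
  using p_pos by (auto simp: field_norm_eq)

lemma norm_shift:
  assumes "c \<in> K"
  shows "field_norm K (\<alpha> - c) = (\<alpha> - c) ^ p - (\<alpha> - c)"
proof -
  have "(\<sigma> ^^ i) (\<alpha> - c) = (\<alpha> - c) + of_nat i" for i
    using sigma_pow_add[of i "\<alpha> - c" c] sigma_pow_fix[OF assms, of i]
    by (simp add: sigma_pow_alpha algebra_simps)
  then show ?thesis by (simp only: field_norm_eq prod_add_of_nat)
qed

end

section \<open>Valuation rings\<close>

locale valuation =
  fixes v :: "'a::field \<Rightarrow> 'g::linordered_ab_group_add"
  assumes valuation_on: "valuation_on UNIV v"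
begin

abbreviation B where "B \<equiv> val_ring UNIV v"
abbreviation M where "M \<equiv> val_max_ideal UNIV v"

lemma v_mult: "x \<noteq> 0 \<Longrightarrow> y \<noteq> 0 \<Longrightarrow> v (x * y) = v x + v y"
  and v_add: "x \<noteq> 0 \<Longrightarrow> y \<noteq> 0 \<Longrightarrow> x + y \<noteq> 0 \<Longrightarrow> min (v x) (v y) \<le> v (x + y)"
  using valuation_on by (auto simp: valuation_on_def)

lemma v_1 [simp]: "v 1 = 0"
  using v_mult[of 1 1] by simp

lemma v_uminus [simp]: "v (- x) = v x"
proof (cases "x = 0")
  case False
  have "v (-1) + v (-1) = 0" using v_mult[of "-1" "-1"] by simp
  then have "v (-1) = 0" by simp
  then show ?thesis using v_mult[of "-1" x] False by simp
qed simp

lemma v_inverse: "x \<noteq> 0 \<Longrightarrow> v (inverse x) = - v x"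
  using v_mult[of x "inverse x"] by (simp add: eq_neg_iff_add_eq_0 add.commute)

lemma v_divide: "x \<noteq> 0 \<Longrightarrow> y \<noteq> 0 \<Longrightarrow> v (x / y) = v x - v y"
  by (simp add: divide_inverse v_mult v_inverse)

lemma v_prod: "(\<And>i. i \<in> I \<Longrightarrow> g i \<noteq> 0) \<Longrightarrow> v (prod g I) = (\<Sum>i\<in>I. v (g i))"
  by (induction I rule: infinite_finite_induct) (auto simp: v_mult)

lemma mem_B: "x \<in> B \<longleftrightarrow> x = 0 \<or> 0 \<le> v x" and mem_M: "x \<in> M \<longleftrightarrow> x = 0 \<or> 0 < v x"
  by (auto simp: val_ring_def val_max_ideal_def)

lemma divide_mem_B: "x \<noteq> 0 \<Longrightarrow> x / y \<in> B \<longleftrightarrow> y = 0 \<or> v y \<le> v x"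
  and divide_mem_M: "x \<noteq> 0 \<Longrightarrow> x / y \<in> M \<longleftrightarrow> y = 0 \<or> v y < v x"
  by (cases "y = 0"; auto simp: mem_B mem_M v_divide)+

sublocale B: unital_subring B
proof
  fix x y assume *: "x \<in> B" "y \<in> B"
  show "x + y \<in> B"
  proof (cases "x = 0 \<or> y = 0 \<or> x + y = 0")
    case False
    then have "0 \<le> min (v x) (v y)" using * by (simp add: mem_B)
    also have "\<dots> \<le> v (x + y)" using False by (intro v_add) auto
    finally show ?thesis by (simp add: mem_B)
  qed (use * in \<open>auto simp: mem_B\<close>)
  show "x * y \<in> B"
    using * v_mult[of x y] by (cases "x = 0 \<or> y = 0") (auto simp: mem_B)
qed (auto simp: mem_B)

lemma M_subset_B: "x \<in> M \<Longrightarrow> x \<in> B"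
  by (auto simp: mem_B mem_M)

lemma M_add:
  assumes "x \<in> M" "y \<in> M"
  shows "x + y \<in> M"
proof (cases "x = 0 \<or> y = 0 \<or> x + y = 0")
  case False
  then have "0 < min (v x) (v y)" using assms by (simp add: mem_M)
  also have "\<dots> \<le> v (x + y)" using False by (intro v_add) auto
  finally show ?thesis by (simp add: mem_M)
qed (use assms in \<open>auto simp: mem_M\<close>)

lemma M_uminus: "x \<in> M \<Longrightarrow> - x \<in> M"
  by (auto simp: mem_M)

lemma M_diff: "x \<in> M \<Longrightarrow> y \<in> M \<Longrightarrow> x - y \<in> M"
  using M_add[of x "- y"] M_uminus[of y] by simp

lemma M_mult: "x \<in> M \<Longrightarrow> y \<in> B \<Longrightarrow> x * y \<in> M"
  using v_mult[of x y] by (cases "x = 0 \<or> y = 0") (auto simp: mem_M mem_B add_pos_nonneg)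

lemma M_mult': "x \<in> B \<Longrightarrow> y \<in> M \<Longrightarrow> x * y \<in> M"
  using M_mult[of y x] by (simp add: mult.commute)

lemma M_zero: "0 \<in> M"
  by (simp add: mem_M)

lemma M_sum: "(\<And>i. i \<in> I \<Longrightarrow> g i \<in> M) \<Longrightarrow> sum g I \<in> M"
  by (induction I rule: infinite_finite_induct) (auto intro: M_add M_zero)

lemma one_not_mem_M: "1 \<notin> M"
  by (simp add: mem_M)

lemma inverse_mem_M: "x \<notin> B \<Longrightarrow> inverse x \<in> M"
  by (auto simp: mem_B mem_M v_inverse)

lemma unit_1_plus_M:
  assumes "x \<in> M"
  shows "1 + x \<noteq> 0" "v (1 + x) = 0"
proof -
  show nz: "1 + x \<noteq> 0"
    using assms one_not_mem_M M_uminus by (metis add_eq_0_iff add.inverse_inverse)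
  have "1 + x \<in> B" using assms M_subset_B by (intro B.add_mem B.one_mem)
  moreover have "1 + x \<notin> M"
    using M_diff[of "1 + x" x] assms one_not_mem_M by auto
  ultimately show "v (1 + x) = 0" using nz by (auto simp: mem_B mem_M)
qed

text \<open>
  Divide by a coefficient of least value.
\<close>
lemma poly_normalize:
  assumes "Q \<noteq> 0"
  obtains n where "Polynomial.coeff Q n \<noteq> 0"
    "Polynomial.smult (inverse (Polynomial.coeff Q n)) Q \<in> poly_over B"
proof -
  define I where "I = {i. i \<le> Polynomial.degree Q \<and> Polynomial.coeff Q i \<noteq> 0}"
  have "finite I" by (rule finite_subset[of _ "{..Polynomial.degree Q}"]) (auto simp: I_def)
  moreover have "Polynomial.degree Q \<in> I" using assms by (simp add: I_def)
  ultimately obtain n where n: "n \<in> I" "\<And>i. i \<in> I \<Longrightarrow> v (Polynomial.coeff Q n) \<le> v (Polynomial.coeff Q i)"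
    using arg_min_if_finite[of I "\<lambda>i. v (Polynomial.coeff Q i)"] by (metis empty_iff leI)
  have "Polynomial.coeff Q i / Polynomial.coeff Q n \<in> B" for i
  proof (cases "Polynomial.coeff Q i = 0")
    case False
    then have "i \<in> I" by (simp add: I_def Polynomial.le_degree)
    then show ?thesis using n(2) False by (simp add: divide_mem_B)
  qed (simp add: B.zero_mem)
  then show thesis using n(1) by (intro that[of n]) (auto simp: I_def poly_over_def field_simps)
qed

text \<open>
  Modulo \<open>M\<close> this says: if \<open>X ^ n\<close> divides \<open>P Q\<close> and \<open>P\<close> has a simple root at 0, then \<open>X ^ (n - 1)\<close>
  divides \<open>Q\<close>.  The coefficient of \<open>P Q\<close> at \<open>j + 1\<close> determines that of \<open>Q\<close> at \<open>j\<close> modulo \<open>M\<close>.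
\<close>
lemma cofactor_coeffs_mem_M:
  assumes "P \<in> poly_over B" "Q \<in> poly_over B" "Polynomial.coeff P 0 \<in> M" "Polynomial.coeff P 1 = 1"
    and "\<And>j. j < n \<Longrightarrow> Polynomial.coeff (P * Q) j \<in> M"
    and "Suc j < n"
  shows "Polynomial.coeff Q j \<in> M"
  using assms(6)
proof (induction j rule: less_induct)
  case (less j)
  define t where "t i = Polynomial.coeff P i * Polynomial.coeff Q (Suc j - i)" for i
  have "Polynomial.coeff (P * Q) (Suc j) = sum t {..Suc j}"
    by (simp add: coeff_mult t_def)
  also have "{..Suc j} = insert 0 (insert 1 {2..Suc j})" by auto
  also have "sum t \<dots> = t 0 + (Polynomial.coeff Q j + sum t {2..Suc j})"
    using assms(4) by (simp add: t_def)
  finally have "Polynomial.coeff Q j = Polynomial.coeff (P * Q) (Suc j) - (t 0 + sum t {2..Suc j})"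
    by simp
  moreover have "t i \<in> M" if "i \<in> {2..Suc j}" for i
    unfolding t_def using that less.prems assms(1)
    by (intro M_mult' less.IH) (auto simp: poly_over_def)
  moreover have "t 0 \<in> M"
    unfolding t_def using assms(2,3) by (intro M_mult) (auto simp: poly_over_def)
  ultimately show ?case using assms(5)[OF less.prems] by (auto intro!: M_diff M_add M_sum)
qed

end

section \<open>Invariance of a henselian valuation under the Galois group\<close>

locale artin_schreier_valued = artin_schreier p K \<sigma> \<alpha> + valuation v
  for p :: nat and K :: "'a::field set" and \<sigma> :: "'a \<Rightarrow> 'a" and \<alpha> :: 'a
    and v :: "'a \<Rightarrow> 'g::linordered_ab_group_add"
begin

text \<open>
  Let \<open>S\<close> be the set of all \<open>i\<close> modulo \<open>p\<close> for which \<open>v (\<sigma>\<^sup>i z)\<close> is least, and \<open>y\<close> the product of these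
  conjugates.  The value of \<open>\<sigma>\<^sup>j y\<close> is the sum of the values of \<open>\<sigma>\<^sup>i z\<close> over the translate \<open>S + j\<close>, so it
  exceeds that of \<open>y\<close> unless \<open>S + j = S\<close>.  As \<open>p\<close> is prime, a nonempty set stable under a nonzero
  translation is everything, whereas \<open>z\<close> and \<open>\<sigma> z\<close> have different values.
\<close>
lemma exists_isolated_conjugate:
  assumes z: "z \<noteq> 0" and neq: "v (\<sigma> z) \<noteq> v z"
  obtains y where "y \<noteq> 0" "\<And>j. 0 < j \<Longrightarrow> j < p \<Longrightarrow> v y < v ((\<sigma> ^^ j) y)"
proof -
  define a where "a n = v ((\<sigma> ^^ n) z)" for n
  have per: "a (n + p * k) = a n" for n k
  proof (induction k)
    case (Suc k)
    have "(\<sigma> ^^ (p + (n + p * k))) z = (\<sigma> ^^ (n + p * k)) z"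
      by (simp add: funpow_add sigma_pow_p)
    with Suc show ?case by (simp add: a_def algebra_simps)
  qed simp
  define m where "m = Min (a ` {..<p})"
  define S where "S = {i. i < p \<and> a i = m}"
  have m_le: "m \<le> a n" for n
  proof -
    have "a n = a (n mod p)" using per[of "n mod p" "n div p"] by simp
    also have "m \<le> \<dots>" unfolding m_def using p_pos by (intro Min_le) auto
    finally show ?thesis .
  qed
  have "m \<in> a ` {..<p}" unfolding m_def using p_pos by (intro Min_in) auto
  then obtain i0 where i0: "i0 \<in> S" by (auto simp: S_def)
  define y where "y = (\<Prod>i\<in>S. (\<sigma> ^^ i) z)"
  have y0: "y \<noteq> 0" using z by (simp add: y_def S_def)
  have vy: "v ((\<sigma> ^^ j) y) = (\<Sum>i\<in>S. a (j + i))" for j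
  proof -
    have "(\<sigma> ^^ j) y = (\<Prod>i\<in>S. (\<sigma> ^^ (j + i)) z)" by (simp add: y_def sigma_pow_prod funpow_add)
    then show ?thesis using z by (simp add: v_prod a_def)
  qed
  have "v y < v ((\<sigma> ^^ j) y)" if j: "0 < j" "j < p" for j
  proof -
    have "\<exists>i\<in>S. a (j + i) \<noteq> m"
    proof (rule ccontr)
      assume "\<not> ?thesis"
      then have stable: "a (j + n) = m" if "a n = m" for n
        using that per[of "n mod p" "n div p"] per[of "j + n mod p" "n div p"] p_pos
        by (auto simp: S_def add.assoc)
      have orbit: "a (i0 + j * k) = m" for k
        using i0 stable[of "i0 + j * k" for k] by (induction k) (auto simp: S_def algebra_simps)
      have "coprime j p"
        using prime_p j by (metis coprime_commute nat_dvd_not_less prime_imp_coprime)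
      then obtain r s where rs: "j * r = p * s + 1"
        using bezout_nat[of j p] j by (auto simp: coprime_iff_gcd_eq_1)
      have "a n = m" for n
      proof -
        obtain q where q: "p = Suc q" using p_pos by (cases p) auto
        \<comment> \<open>As \<open>r\<close> inverts \<open>j\<close> modulo \<open>p\<close> and \<open>q \<equiv> -1\<close>, this number of steps by \<open>j\<close> leads from \<open>i0\<close> to \<open>n\<close>
          modulo \<open>p\<close>, without subtraction.\<close>
        have "i0 + j * (r * (n + q * i0)) = i0 + (j * r) * (n + q * i0)" by simp
        also have "\<dots> = n + p * (i0 + s * (n + q * i0))"
          unfolding rs by (simp add: q algebra_simps)
        finally show ?thesis using orbit[of "r * (n + q * i0)"] per by simp
      qed
      then have "a 1 = a 0" by simp
      with neq show False by (simp add: a_def)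
    qed
    then have "(\<Sum>i\<in>S. m) < (\<Sum>i\<in>S. a (j + i))"
      using m_le by (intro sum_strict_mono_ex1) (auto simp: S_def less_le)
    also have "(\<Sum>i\<in>S. m) = v y" using vy[of 0] by (simp add: S_def)
    finally show ?thesis by (simp add: vy)
  qed
  with y0 that show thesis by blast
qed

lemma char_poly_over_K:
  "(\<Prod>i<p. [:- (\<sigma> ^^ i) x, 1:]) \<in> poly_over K"
proof -
  have *: "\<sigma> (Polynomial.coeff (\<Prod>i\<in>I. [:- g i, 1:]) k) = Polynomial.coeff (\<Prod>i\<in>I. [:- \<sigma> (g i), 1:]) k"
    if "finite I" for I :: "nat set" and g k
    using that
  proof (induction I arbitrary: k)
    case empty
    then show ?case by (auto simp: sigma_fix K.one_mem)
  next
    case (insert i I)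
    have diff: "\<sigma> (x - y) = \<sigma> x - \<sigma> y" for x y
      using sigma_add[of "x - y" y] by (simp add: algebra_simps)
    have neg: "\<sigma> (- y) = - \<sigma> y" for y
      using diff[of 0 y] by simp
    have "\<sigma> (Polynomial.coeff (\<Prod>i\<in>I. [:- g i, 1:]) k) = Polynomial.coeff (\<Prod>i\<in>I. [:- \<sigma> (g i), 1:]) k" for k
      by (rule insert.IH)
    then show ?case using insert(1,2)
      by (auto simp: sigma_mult coeff_pCons neg diff split: nat.split)
  qed
  have "\<sigma> (Polynomial.coeff (\<Prod>i<p. [:- (\<sigma> ^^ i) x, 1:]) k) = Polynomial.coeff (\<Prod>i<p. [:- (\<sigma> ^^ i) x, 1:]) k" for k
    using *[of "{..<p}" "\<lambda>i. (\<sigma> ^^ i) x" k]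
      prod_cyclic_shift[of "\<lambda>i. [:- (\<sigma> ^^ i) x, 1:]" p] by (simp add: sigma_pow_p)
  then show ?thesis using fixed_mem by (simp add: poly_over_def)
qed

text \<open>
  Dividing an element with one conjugate of strictly least value by its trace gives an \<open>x\<close> congruent to
  1 whose other conjugates lie in \<open>M\<close>.  Then 1 is a simple root of the characteristic polynomial of \<open>x\<close>
  modulo \<open>M\<close>.
\<close>
theorem henselian_imp_v_sigma:
  assumes hensel: "henselian K v" and "z \<noteq> 0"
  shows "v (\<sigma> z) = v z"
proof (rule ccontr)
  assume "v (\<sigma> z) \<noteq> v z"
  then obtain y where y: "y \<noteq> 0" "\<And>j. 0 < j \<Longrightarrow> j < p \<Longrightarrow> v y < v ((\<sigma> ^^ j) y)"
    using exists_isolated_conjugate assms(2) by blast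
  define t where "t = (\<Sum>i<p. (\<sigma> ^^ i) y)"
  define w where "w = (\<Sum>i\<in>{1..<p}. (\<sigma> ^^ i) y)"
  define x where "x = y / t"
  have "\<sigma> t = t"
    using sum_cyclic_shift[of "\<lambda>i. (\<sigma> ^^ i) y" p] by (simp add: t_def sigma_sum sigma_pow_p)
  then have tK: "t \<in> K" by (rule fixed_mem)
  have t: "t = y + w"
    unfolding t_def w_def lessThan_atLeast0 using p_pos by (simp add: sum.atLeast_Suc_lessThan)
  have conj_M: "(\<sigma> ^^ i) y / y \<in> M" if "0 < i" "i < p" for i
    using y that by (simp add: divide_mem_M)
  have "w / y = (\<Sum>i\<in>{1..<p}. (\<sigma> ^^ i) y / y)" by (simp add: w_def sum_divide_distrib)
  also have "\<dots> \<in> M" by (intro M_sum conj_M) auto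
  finally have wM: "w / y \<in> M" .
  have ty: "t = y * (1 + w / y)" using y(1) t by (simp add: field_simps)
  have t0: "t \<noteq> 0" and vt: "v t = v y"
    using unit_1_plus_M[OF wM] y(1) by (auto simp: ty v_mult)
  have xB: "x \<in> B" using y(1) t0 vt by (simp add: x_def divide_mem_B)
  have x1: "1 - x \<in> M"
  proof -
    have "1 - x = (w / y) * x" using t0 y(1) by (simp add: x_def t field_simps)
    then show ?thesis using M_mult[OF wM xB] by simp
  qed
  have xM: "(\<sigma> ^^ i) x \<in> M" if "0 < i" "i < p" for i
  proof -
    have "(\<sigma> ^^ i) x * (\<sigma> ^^ i) t = (\<sigma> ^^ i) y"
      using sigma_pow_mult[of i x t] t0 by (simp add: x_def)
    then have "(\<sigma> ^^ i) x * t = (\<sigma> ^^ i) y" using sigma_pow_fix[OF tK] by simp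
    then have "(\<sigma> ^^ i) x = ((\<sigma> ^^ i) y / y) * x" using t0 y(1) by (simp add: x_def field_simps)
    then show ?thesis using M_mult[OF conj_M[OF that] xB] by simp
  qed
  \<comment> \<open>The characteristic polynomial \<open>C\<close> is split as \<open>(X - x) R\<close>, and \<open>R\<close> has unit value at 1.\<close>
  define R where "R = (\<Prod>i\<in>{1..<p}. [:- (\<sigma> ^^ i) x, 1:])"
  define C where "C = (\<Prod>i<p. [:- (\<sigma> ^^ i) x, 1:])"
  have CR: "C = [:- x, 1:] * R"
    unfolding C_def R_def lessThan_atLeast0 using p_pos by (simp add: prod.atLeast_Suc_lessThan)
  have RB: "R \<in> poly_over B"
    unfolding R_def using xM M_subset_B
    by (intro B.poly_over_prod B.poly_over_pCons B.poly_over_0 B.mem_intros) auto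
  have CB: "C \<in> poly_over B"
    unfolding CR by (intro B.poly_over_mult RB B.poly_over_pCons B.poly_over_0 B.mem_intros xB)
  have "C \<in> poly_over K" unfolding C_def by (rule char_poly_over_K)
  with CB have C_coeff: "\<forall>i. Polynomial.coeff C i \<in> val_ring K v"
    by (auto simp: poly_over_def val_ring_def)
  have C_monic: "Polynomial.lead_coeff C = 1"
    unfolding C_def by (subst Polynomial.lead_coeff_prod) simp
  have "poly C 1 = (1 - x) * poly R 1" by (simp add: CR algebra_simps)
  also have "\<dots> \<in> M" by (intro M_mult x1 B.poly_mem RB B.one_mem)
  finally have C1: "poly C 1 \<in> M" .
  have "poly C 1 \<in> K" using \<open>C \<in> poly_over K\<close> by (intro K.poly_mem K.one_mem)
  with C1 have C1': "poly C 1 \<in> val_max_ideal K v" by (auto simp: val_max_ideal_def)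
  have R1: "poly R 1 \<notin> M"
  proof -
    have unit: "1 - (\<sigma> ^^ i) x \<noteq> 0" "v (1 - (\<sigma> ^^ i) x) = 0" if "i \<in> {1..<p}" for i
      using unit_1_plus_M[OF M_uminus[OF xM[of i]]] that by auto
    have R1_eq: "poly R 1 = (\<Prod>i\<in>{1..<p}. 1 - (\<sigma> ^^ i) x)" by (simp add: R_def poly_prod)
    have "v (poly R 1) = (\<Sum>i\<in>{1..<p}. v (1 - (\<sigma> ^^ i) x))"
      unfolding R1_eq by (intro v_prod unit(1))
    also have "\<dots> = 0" by (intro sum.neutral ballI unit(2))
    finally have "v (poly R 1) = 0" .
    moreover have "poly R 1 \<noteq> 0" unfolding R1_eq using unit(1) by (subst prod_zero_iff) auto
    ultimately show ?thesis by (simp add: mem_M)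
  qed
  have "poly (pderiv C) 1 = poly R 1 + (1 - x) * poly (pderiv R) 1"
    unfolding CR by (simp only: pderiv_mult poly_add poly_mult) (simp add: pderiv_pCons)
  moreover have "(1 - x) * poly (pderiv R) 1 \<in> M"
    by (intro M_mult x1 B.poly_mem B.poly_over_pderiv RB B.one_mem)
  ultimately have "poly (pderiv C) 1 \<notin> M"
    using R1 M_diff[of "poly (pderiv C) 1" "(1 - x) * poly (pderiv R) 1"] by auto
  then have C1'': "poly (pderiv C) 1 \<notin> val_max_ideal K v" by (auto simp: val_max_ideal_def)
  have "1 \<in> val_ring K v" by (simp add: val_ring_def K.one_mem)
  \<comment> \<open>The lifted root is a conjugate of \<open>x\<close>, so \<open>x\<close> is in \<open>K\<close> and equals its conjugates, one of which is
    in \<open>M\<close>.\<close>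
  then obtain b where b: "b \<in> val_ring K v" "poly C b = 0"
    using hensel C_coeff C_monic C1' C1'' unfolding henselian_def by blast
  from b(2) obtain i where i: "i < p" "b = (\<sigma> ^^ i) x"
    by (auto simp: C_def poly_prod)
  have bK: "b \<in> K" using b(1) by (simp add: val_ring_def)
  have "x = (\<sigma> ^^ (p - i + i)) x" using i(1) by (simp add: sigma_pow_p)
  also have "\<dots> = b" using i(2) sigma_pow_fix[OF bK] by (simp only: funpow_add o_apply)
  finally have "\<sigma> x = x" using bK sigma_fix by simp
  then have "x \<in> M" using xM[of 1] p_gt_1 by simp
  then have "1 \<in> M" using M_add[OF x1] by fastforce
  then show False using one_not_mem_M by blast
qed

end

section \<open>Bounding differences by shifts of the generator\<close>

lemma degree_pderiv_less:
  assumes "0 < Polynomial.degree P"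
  shows "Polynomial.degree (pderiv P) < Polynomial.degree (P :: 'a::field poly)"
  using assms by (intro Polynomial.degree_lessI) (auto simp: coeff_pderiv Polynomial.coeff_eq_0)

locale artin_schreier_invariant = artin_schreier_valued p K \<sigma> \<alpha> v
  for p :: nat and K :: "'a::field set" and \<sigma> :: "'a \<Rightarrow> 'a" and \<alpha> :: 'a
    and v :: "'a \<Rightarrow> 'g::linordered_ab_group_add" +
  assumes v_sigma: "z \<noteq> 0 \<Longrightarrow> v (\<sigma> z) = v z"
begin

lemma sigma_mem_B: "x \<in> B \<Longrightarrow> \<sigma> x \<in> B"
  using v_sigma[of x] by (cases "x = 0") (auto simp: mem_B)

lemma sigma_mem_M: "x \<in> M \<Longrightarrow> \<sigma> x \<in> M"
  using v_sigma[of x] by (cases "x = 0") (auto simp: mem_M)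

lemma shift_nonzero: "c \<in> K \<Longrightarrow> \<alpha> - c \<noteq> 0"
  using alpha_not_mem by auto

lemma sigma_shift: "c \<in> K \<Longrightarrow> \<sigma> (\<alpha> - c) = (\<alpha> - c) + 1"
  using sigma_add[of "\<alpha> - c" c] sigma_fix[of c] by (simp add: sigma_alpha algebra_simps)

text \<open>
  A shift of positive value would make \<open>1 = \<sigma> (\<alpha> - c) - (\<alpha> - c)\<close> an element of \<open>M\<close>.
\<close>
lemma v_shift_le:
  assumes "c \<in> K"
  shows "v (\<alpha> - c) \<le> 0"
proof (rule ccontr)
  assume "\<not> ?thesis"
  then have M: "\<alpha> - c \<in> M" by (auto simp: mem_M)
  from M_diff[OF sigma_mem_M[OF M] M] have "1 \<in> M" by (simp add: sigma_shift assms)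
  then show False using one_not_mem_M by blast
qed

lemma inverse_shift_mem_B: "c \<in> K \<Longrightarrow> inverse (\<alpha> - c) \<in> B"
  using v_shift_le shift_nonzero by (simp add: mem_B v_inverse)

lemma inverse_of_nat_mem_B: "inverse (of_nat i) \<in> B"
proof (cases "of_nat i = (0::'a)")
  case False
  have "p = Suc (Suc (p - 2))" using p_gt_1 by simp
  then have "(of_nat i :: 'a) ^ Suc (Suc (p - 2)) = of_nat i"
    by (metis of_nat_power_p)
  then have "of_nat i ^ (p - 2) = inverse (of_nat i :: 'a)"
    using False by (simp add: field_simps)
  then show ?thesis using B.power_mem[OF B.of_nat_mem] by metis
qed (simp add: B.zero_mem)

abbreviation taylor where "taylor P y \<equiv> pcompose P [:\<alpha>, y:]"

text \<open>
  The coefficient of \<open>P (\<alpha> + y X)\<close> at \<open>j\<close> is \<open>P\<^sub>j y ^ j\<close>, and dominated means that none of these has smaller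
  value than \<open>P \<alpha>\<close>.  Division by \<open>P \<alpha>\<close> turns this into integrality of coefficients, so that no value of 0
  has to be considered.
\<close>
definition taylor_dominated where
  "taylor_dominated P y \<longleftrightarrow> Polynomial.smult (inverse (poly P \<alpha>)) (taylor P y) \<in> poly_over B"

lemma coeff_0_taylor: "Polynomial.coeff (taylor P y) 0 = poly P \<alpha>"
  by (simp add: pcompose_coeff_0)

lemma taylor_scale: "taylor P (e * y) = pcompose (taylor P y) [:0, e:]"
proof -
  have "[:\<alpha>, e * y:] = pcompose [:\<alpha>, y:] [:0, e:]" by (simp add: pcompose_pCons mult.commute)
  then show ?thesis by (simp add: pcompose_assoc)
qed

lemma taylor_dominated_mult:
  assumes "taylor_dominated P y" "e \<in> B"
  shows "taylor_dominated P (e * y)"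
  using assms B.mult_mem[OF B.power_mem[OF assms(2)]]
  by (simp add: taylor_dominated_def poly_over_def taylor_scale coeff_pcompose_linear mult.left_commute)

text \<open>
  Domination persists when the shift grows in value, so finitely many polynomials can be treated at a
  common shift.
\<close>
lemma taylor_dominated_finer:
  assumes "taylor_dominated P (\<alpha> - c)" "c \<in> K" "c' \<in> K" "v (\<alpha> - c) \<le> v (\<alpha> - c')"
  shows "taylor_dominated P (\<alpha> - c')"
proof -
  have "(\<alpha> - c') / (\<alpha> - c) \<in> B"
    using assms shift_nonzero by (simp add: divide_mem_B)
  from taylor_dominated_mult[OF assms(1) this] show ?thesis using shift_nonzero[OF assms(2)] by simp
qed

text \<open>
  \<open>G = P (\<alpha> + y X) / P \<alpha>\<close> has integral coefficients, constant term 1, and takes the value \<open>\<sigma> b / b\<close> at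
  \<open>1 / y \<in> B\<close>.  So \<open>\<sigma> b / b - 1\<close> is \<open>1 / y\<close> times an integral element.
\<close>
lemma taylor_dominated_difference:
  assumes P: "P \<in> poly_over K" "poly P \<alpha> \<noteq> 0" and c: "c \<in> K" and dominated: "taylor_dominated P (\<alpha> - c)"
  shows "(\<sigma> (poly P \<alpha>) / poly P \<alpha> - 1) * (\<alpha> - c) \<in> B"
proof -
  define y where "y = \<alpha> - c"
  define G where "G = Polynomial.smult (inverse (poly P \<alpha>)) (taylor P y)"
  obtain g G' where G': "G = pCons g G'" by (cases G)
  have y0: "y \<noteq> 0" using shift_nonzero[OF c] by (simp add: y_def)
  have "poly G (inverse y) = \<sigma> (poly P \<alpha>) / poly P \<alpha>"
    using y0 P(1) by (simp add: G_def poly_pcompose sigma_poly sigma_alpha divide_inverse mult.commute)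
  moreover have "g = 1"
    using G' P(2) coeff_0_taylor[of P y] by (metis G_def coeff_pCons_0 coeff_smult left_inverse)
  ultimately have "(\<sigma> (poly P \<alpha>) / poly P \<alpha> - 1) * y = poly G' (inverse y)"
    using y0 G' by (simp add: field_simps)
  also have "\<dots> \<in> B"
  proof (rule B.poly_mem)
    have "Polynomial.coeff G (Suc i) \<in> B" for i using dominated by (simp add: taylor_dominated_def G_def y_def poly_over_def)
    then show "G' \<in> poly_over B" by (simp add: G' poly_over_def)
    show "inverse y \<in> B" using inverse_shift_mem_B[OF c] by (simp add: y_def)
  qed
  finally show ?thesis by (simp add: y_def)
qed

lemma taylor_AS_poly: "taylor AS_poly y = Polynomial.monom (y ^ p) p - [:0, y:]"
proof -
  have "pcompose (Polynomial.monom 1 p) q = q ^ p" for q :: "'a poly"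
  proof -
    have "pcompose ([:0, 1:] ^ n) q = q ^ n" for n
      by (induction n) (simp_all add: pcompose_mult pcompose_pCons pcompose_1)
    then show ?thesis by (simp add: Polynomial.monom_altdef)
  qed
  moreover have "[:\<alpha>, y:] ^ p = [:\<alpha>:] ^ p + (Polynomial.monom y 1) ^ p"
  proof -
    have "[:\<alpha>, y:] = [:\<alpha>:] + Polynomial.monom y 1" by (simp add: Polynomial.monom_altdef)
    then show ?thesis using prime_p char by (simp only: freshmans_dream semiring_char_poly)
  qed
  ultimately show ?thesis
    by (simp add: AS_poly_def pcompose_diff pcompose_pCons Polynomial.monom_power poly_const_pow)
qed

lemma AS_poly_mod_over:
  assumes P: "P \<in> poly_over K" "P \<noteq> 0"
  shows "AS_poly mod P \<in> poly_over K"
proof -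
  let ?l = "Polynomial.lead_coeff P"
  have l: "?l \<in> K" "?l \<noteq> 0" using P by (auto simp: poly_over_def)
  have "AS_poly mod Polynomial.smult (inverse ?l) P \<in> poly_over K"
    using l P(1) by (intro poly_over_mod AS_poly_over K.poly_over_smult K_inverse K.unital_subring_axioms) auto
  then show ?thesis using l by (simp add: Polynomial.mod_smult_right)
qed

text \<open>
  Failure of domination makes \<open>\<alpha>\<close> a simple approximate root of \<open>P\<close>, which forces the quotient of
  \<open>X ^ p - X - f\<close> by \<open>P\<close> to have degree at least \<open>p - 1\<close>.  In the proof \<open>Q\<close> and \<open>U\<close> are the normalised
  expansions of \<open>P\<close> and of the quotient \<open>S\<close>, and the congruence \<open>Q U \<equiv> \<theta> X ^ p\<close> modulo \<open>M\<close> contradicts the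
  fact that \<open>U\<close> has a coefficient 1 below \<open>X ^ (p - 1)\<close>.
\<close>
lemma taylor_dominated_step:
  assumes y0: "y \<noteq> 0" and neg: "inverse y \<in> M"
    and P: "P \<in> poly_over K" "2 \<le> Polynomial.degree P" "Polynomial.degree P < p"
    and dominated_pderiv: "taylor_dominated (pderiv P) y" and dominated_mod: "taylor_dominated (AS_poly mod P) y"
  shows "taylor_dominated P y"
proof (rule ccontr)
  assume bad: "\<not> taylor_dominated P y"
  define d where "d = Polynomial.degree P"
  have P0: "P \<noteq> 0" using P(2) by auto
  have Pa: "poly P \<alpha> \<noteq> 0" using P P0 by (intro poly_alpha_nonzero)
  have "Polynomial.coeff (pderiv P) (d - 1) \<noteq> 0"
    using P(2,3) P0 of_nat_eq_0[of d] unfolding d_def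
    by (auto simp: coeff_pderiv dest: dvd_imp_le simp flip: of_nat_Suc)
  then have "pderiv P \<noteq> 0" by auto
  moreover have "Polynomial.degree (pderiv P) < p"
    using degree_pderiv_less[of P] P(2,3) by simp
  ultimately have P'a: "poly (pderiv P) \<alpha> \<noteq> 0"
    using P(1) by (intro poly_alpha_nonzero K.poly_over_pderiv)
  define G where "G = taylor P y"
  define g where "g = y * poly (pderiv P) \<alpha>"
  have g0: "g \<noteq> 0" using y0 P'a by (simp add: g_def)
  have dG: "pderiv G = Polynomial.smult y (taylor (pderiv P) y)"
    by (simp add: G_def pderiv_pcompose pderiv_pCons)
  have G_Suc: "of_nat (Suc i) * Polynomial.coeff G (Suc i) = y * Polynomial.coeff (taylor (pderiv P) y) i" for i
    using arg_cong[OF dG, of "\<lambda>Q. Polynomial.coeff Q i"] by (simp add: coeff_pderiv)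
  have G1: "Polynomial.coeff G 1 = g"
    using G_Suc[of 0] by (simp add: g_def coeff_0_taylor)
  \<comment> \<open>Domination of the derivative makes the linear coefficient \<open>g\<close> least in value among those of positive
    degree; the factors \<open>i + 1 < p\<close> from differentiation are units.\<close>
  have GB: "Polynomial.coeff G (Suc i) / g \<in> B" for i
  proof (cases "Suc i < p")
    case True
    then have nz: "of_nat (Suc i) \<noteq> (0::'a)" using of_nat_eq_0[of "Suc i"] by (auto dest: dvd_imp_le)
    have "Polynomial.coeff G (Suc i) = inverse (of_nat (Suc i)) * (y * Polynomial.coeff (taylor (pderiv P) y) i)"
      unfolding G_Suc[symmetric] using nz by (simp add: field_simps del: of_nat_Suc)
    then have "Polynomial.coeff G (Suc i) / g
        = inverse (of_nat (Suc i)) * (inverse (poly (pderiv P) \<alpha>) * Polynomial.coeff (taylor (pderiv P) y) i)"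
      using y0 by (simp add: g_def field_simps del: of_nat_Suc)
    also have "\<dots> \<in> B"
      using dominated_pderiv by (intro B.mult_mem[OF inverse_of_nat_mem_B]) (simp add: taylor_dominated_def poly_over_def)
    finally show ?thesis .
  next
    case False
    then have "Polynomial.degree G < Suc i" using P(3) Polynomial.degree_pcompose_le[of P "[:\<alpha>, y:]"]
      by (simp add: G_def split: if_splits)
    then show ?thesis by (simp add: Polynomial.coeff_eq_0 B.zero_mem)
  qed
  \<comment> \<open>So failure of domination can only come from the constant coefficient exceeding \<open>g\<close> in value.\<close>
  have "g / poly P \<alpha> \<notin> B"
  proof
    assume *: "g / poly P \<alpha> \<in> B"
    have "inverse (poly P \<alpha>) * Polynomial.coeff G i \<in> B" for i
    proof (cases i)
      case 0
      then show ?thesis using Pa by (simp add: G_def coeff_0_taylor B.one_mem)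
    next
      case (Suc j)
      have "inverse (poly P \<alpha>) * Polynomial.coeff G i = (g / poly P \<alpha>) * (Polynomial.coeff G (Suc j) / g)"
        using g0 by (simp add: Suc field_simps)
      then show ?thesis using B.mult_mem[OF * GB] by simp
    qed
    with bad show False by (simp add: taylor_dominated_def poly_over_def G_def)
  qed
  from inverse_mem_M[OF this] have gM: "poly P \<alpha> / g \<in> M" by simp
  define Q where "Q = Polynomial.smult (inverse g) G"
  have QB: "Q \<in> poly_over B"
  proof -
    have "Polynomial.coeff G i / g \<in> B" for i
      using GB gM M_subset_B by (cases i) (auto simp: G_def coeff_0_taylor)
    then show ?thesis by (simp add: Q_def poly_over_def field_simps)
  qed
  have Q0: "Polynomial.coeff Q 0 \<in> M"
    using gM by (simp add: Q_def G_def coeff_0_taylor field_simps)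
  have Q1: "Polynomial.coeff Q 1 = 1" using g0 G1 by (simp add: Q_def)
  define S where "S = AS_poly div P"
  define R where "R = AS_poly mod P"
  have F: "AS_poly = P * S + R" by (simp add: S_def R_def)
  have dR: "Polynomial.degree R < Polynomial.degree P"
    unfolding R_def using P0 P(2) Polynomial.degree_mod_less[of P AS_poly] by auto
  have "Polynomial.degree (P * S) = p"
  proof -
    have "P * S = AS_poly - R" by (simp add: F)
    moreover have "Polynomial.degree (AS_poly - R) = Polynomial.degree AS_poly"
      using dR P(3) degree_AS_poly by (metis add_uminus_conv_diff Polynomial.degree_add_eq_left Polynomial.degree_minus dual_order.strict_trans)
    ultimately show ?thesis by (simp add: degree_AS_poly)
  qed
  moreover from this have S0: "S \<noteq> 0" using p_pos by auto
  ultimately have dS: "Polynomial.degree S + d = p" using P0 by (simp add: Polynomial.degree_mult_eq d_def)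
  define T where "T = taylor S y"
  have dT: "Polynomial.degree T = Polynomial.degree S"
    using y0 by (simp add: T_def Polynomial.degree_pcompose)
  have "T \<noteq> 0" using S0 y0 by (simp add: T_def Polynomial.pcompose_eq_0_iff)
  then obtain n where n: "Polynomial.coeff T n \<noteq> 0"
    "Polynomial.smult (inverse (Polynomial.coeff T n)) T \<in> poly_over B" by (rule poly_normalize)
  define s where "s = Polynomial.coeff T n"
  define U where "U = Polynomial.smult (inverse s) T"
  have s0: "s \<noteq> 0" and UB: "U \<in> poly_over B" and Un: "Polynomial.coeff U n = 1"
    using n by (auto simp: s_def U_def)
  define r where "r = Polynomial.smult (inverse (poly R \<alpha>)) (taylor R y)"
  have rB: "r \<in> poly_over B" using dominated_mod by (simp add: r_def R_def taylor_dominated_def)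
  \<comment> \<open>For \<open>R = 0\<close> both sides are 0, with \<open>inverse 0 = 0\<close>.\<close>
  have R_r: "taylor R y = Polynomial.smult (poly R \<alpha>) r"
  proof (cases "R = 0")
    case False
    have "R \<in> poly_over K" unfolding R_def by (intro AS_poly_mod_over P(1) P0)
    then have "poly R \<alpha> \<noteq> 0" using False dR P(3) by (intro poly_alpha_nonzero) auto
    then show ?thesis by (simp add: r_def)
  qed (simp add: r_def)
  define m where "m = (poly P \<alpha> / g) * (poly S \<alpha> / s)"
  have mM: "m \<in> M"
  proof -
    have "poly S \<alpha> / s = Polynomial.coeff U 0" by (simp add: U_def T_def coeff_0_taylor field_simps)
    then have "poly S \<alpha> / s \<in> B" using UB by (simp add: poly_over_def)
    then show ?thesis unfolding m_def by (intro M_mult gM)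
  qed
  have Ra: "poly R \<alpha> = - (g * s * m)"
  proof -
    have "poly P \<alpha> * poly S \<alpha> + poly R \<alpha> = 0"
      using poly_AS_poly arg_cong[OF F, of "\<lambda>Q. poly Q \<alpha>"] by simp
    then show ?thesis using g0 s0 by (simp add: m_def eq_neg_iff_add_eq_0 add.commute)
  qed
  have main: "Polynomial.monom (y ^ p) p - [:0, y:] = Polynomial.smult (g * s) (Q * U - Polynomial.smult m r)"
  proof -
    have "taylor AS_poly y = G * T + taylor R y"
      by (simp add: F pcompose_add pcompose_mult G_def T_def)
    also have "G = Polynomial.smult g Q" using g0 by (simp add: Q_def)
    also have "T = Polynomial.smult s U" using s0 by (simp add: U_def)
    finally show ?thesis
      by (simp add: R_r Ra taylor_AS_poly smult_diff_right mult.commute)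
  qed
  define \<theta> where "\<theta> = y ^ p / (g * s)"
  have coeff: "Polynomial.coeff (Q * U) j = m * Polynomial.coeff r j
      + (if j = p then \<theta> else if j = 1 then - (y / (g * s)) else 0)" for j
    using arg_cong[OF main, of "\<lambda>W. Polynomial.coeff W j / (g * s)"] g0 s0 p_gt_1
    by (auto simp: \<theta>_def coeff_pCons field_simps split: if_splits nat.splits)
  have mr: "m * Polynomial.coeff r j \<in> M" for j
    using mM rB by (intro M_mult) (auto simp: poly_over_def)
  have "\<theta> = Polynomial.coeff (Q * U) p - m * Polynomial.coeff r p" using coeff[of p] by simp
  also have "\<dots> \<in> B"
    using B.poly_over_mult[OF QB UB] M_subset_B[OF mr] by (intro B.diff_mem) (auto simp: poly_over_def)
  finally have \<theta>B: "\<theta> \<in> B" .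
  \<comment> \<open>The linear term is \<open>\<theta>\<close> times \<open>y ^ (1 - p)\<close>, and \<open>p \<ge> 2\<close>.\<close>
  have linear: "y / (g * s) \<in> M"
  proof -
    obtain q where q: "p = Suc (Suc q)" using p_gt_1 by (metis One_nat_def Suc_lessE less_natE)
    have "y / (g * s) = inverse y * (inverse y ^ q * \<theta>)"
      using y0 by (simp add: \<theta>_def q field_simps)
    also have "\<dots> \<in> M"
      using neg M_subset_B[OF neg] \<theta>B by (intro M_mult B.mult_mem B.power_mem)
    finally show ?thesis .
  qed
  have "Polynomial.coeff (Q * U) j \<in> M" if "j < p" for j
    using that coeff[of j] M_add[OF mr M_uminus[OF linear]] mr by auto
  moreover have "n \<le> Polynomial.degree T" using n(1) by (rule Polynomial.le_degree)
  then have "Suc n < p" using dS dT P(2) by (simp add: d_def)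
  ultimately have "Polynomial.coeff U n \<in> M"
    by (intro cofactor_coeffs_mem_M[OF QB UB Q0 Q1, of p])
  then show False using Un one_not_mem_M by simp
qed

text \<open>
  A linear polynomial with root \<open>c\<close> is dominated at \<open>\<alpha> - c\<close>: this is the only place where the shift is
  dictated by the polynomial.  In higher degree the shift comes from the derivative and from the
  remainder of \<open>X ^ p - X - f\<close>, both of smaller degree.
\<close>
lemma exists_taylor_dominated:
  assumes neg: "\<And>c. c \<in> K \<Longrightarrow> v (\<alpha> - c) < 0"
  shows "P \<in> poly_over K \<Longrightarrow> Polynomial.degree P < p \<Longrightarrow> \<exists>c\<in>K. taylor_dominated P (\<alpha> - c)"
proof (induction "Polynomial.degree P" arbitrary: P rule: less_induct)
  case less
  consider "Polynomial.degree P = 0" | "Polynomial.degree P = 1" | "2 \<le> Polynomial.degree P" by linarith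
  then show ?case
  proof cases
    case 1
    then obtain a where "P = [:a:]" by (rule Polynomial.degree_eq_zeroE)
    then have "taylor_dominated P (\<alpha> - 0)"
      by (cases "a = 0") (auto simp: taylor_dominated_def poly_over_def coeff_pCons B.mem_intros split: nat.split)
    then show ?thesis using K.zero_mem by blast
  next
    case 2
    then obtain a b where P: "P = [:a, b:]" "b \<noteq> 0" by (rule Polynomial.degree1_coeffs)
    define c where "c = - a / b"
    have ab: "a \<in> K" "b \<in> K" using less.prems(1) by (auto simp: P poly_over_def coeff_pCons_0 dest: spec[of _ 0] spec[of _ 1])
    then have c: "c \<in> K" unfolding c_def by (intro K_divide K.uminus_mem)
    have "taylor P (\<alpha> - c) = Polynomial.smult (poly P \<alpha>) [:1, 1:]"
      using P(2) by (simp add: P(1) pcompose_pCons c_def field_simps)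
    moreover have "poly P \<alpha> \<noteq> 0" using less.prems P by (intro poly_alpha_nonzero) auto
    ultimately have "taylor_dominated P (\<alpha> - c)"
      by (auto simp: taylor_dominated_def intro!: B.poly_over_pCons B.poly_over_0 B.one_mem)
    then show ?thesis using c by blast
  next
    case 3
    have "\<exists>c\<in>K. taylor_dominated (pderiv P) (\<alpha> - c)"
      using 3 less.prems degree_pderiv_less[of P]
      by (intro less.hyps K.poly_over_pderiv) auto
    then obtain c1 where c1: "c1 \<in> K" "taylor_dominated (pderiv P) (\<alpha> - c1)" by blast
    have "\<exists>c\<in>K. taylor_dominated (AS_poly mod P) (\<alpha> - c)"
    proof (rule less.hyps)
      have "P \<noteq> 0" using 3 by auto
      then show "AS_poly mod P \<in> poly_over K" by (intro AS_poly_mod_over less.prems(1))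
      show "Polynomial.degree (AS_poly mod P) < Polynomial.degree P"
        using 3 \<open>P \<noteq> 0\<close> Polynomial.degree_mod_less[of P AS_poly] by auto
      then show "Polynomial.degree (AS_poly mod P) < p" using less.prems(2) by simp
    qed
    then obtain c2 where c2: "c2 \<in> K" "taylor_dominated (AS_poly mod P) (\<alpha> - c2)" by blast
    obtain c where c: "c \<in> K" "taylor_dominated (pderiv P) (\<alpha> - c)" "taylor_dominated (AS_poly mod P) (\<alpha> - c)"
    proof (cases "v (\<alpha> - c1) \<le> v (\<alpha> - c2)")
      case True
      then show thesis using c1 c2 taylor_dominated_finer that by blast
    next
      case False
      then have "v (\<alpha> - c2) \<le> v (\<alpha> - c1)" by simp
      then show thesis using c1 c2 taylor_dominated_finer that by blast
    qed
    have "inverse (\<alpha> - c) \<in> M" using neg[OF c(1)] shift_nonzero[OF c(1)] by (simp add: mem_M v_inverse)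
    then have "taylor_dominated P (\<alpha> - c)"
      by (rule taylor_dominated_step[OF shift_nonzero[OF c(1)] _ less.prems(1) 3 less.prems(2) c(2,3)])
    then show ?thesis using c(1) by blast
  qed
qed

text \<open>
  A shift of value 0, if there is one, bounds everything, since \<open>\<sigma> b / b\<close> is a unit.
\<close>
theorem exists_shift_bounding_difference:
  assumes "b \<noteq> 0"
  obtains c where "c \<in> K" "(\<sigma> b / b - 1) * (\<alpha> - c) \<in> B"
proof (cases "\<exists>c\<in>K. 0 \<le> v (\<alpha> - c)")
  case True
  then obtain c where c: "c \<in> K" "0 \<le> v (\<alpha> - c)" by blast
  have "\<sigma> b / b \<in> B" using assms by (simp add: divide_mem_B v_sigma)
  moreover have "\<alpha> - c \<in> B" using c(2) by (subst mem_B) blast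
  ultimately have "(\<sigma> b / b - 1) * (\<alpha> - c) \<in> B"
    using B.mult_mem[OF B.diff_mem[OF _ B.one_mem]] by blast
  with c(1) that show thesis by blast
next
  case False
  obtain P where P: "P \<in> poly_over K" "Polynomial.degree P < p" "b = poly P \<alpha>" by (rule poly_representation)
  from False have "\<exists>c\<in>K. taylor_dominated P (\<alpha> - c)" by (intro exists_taylor_dominated P) force
  then show thesis using taylor_dominated_difference[OF P(1)] assms P(3) that by blast
qed

end

section \<open>The two ideals\<close>

context unital_subring
begin

lemma ring_ring_on: "ring (ring_on S)"
proof -
  interpret R: ring "amb :: 'a ring" by (rule ring_from_type_algebra)
  have "subring S amb" by (rule R.subringI) (auto intro: mem_intros)
  then show ?thesis by (rule R.subring_is_ring)
qed

lemma genideal_incl: "G \<subseteq> S \<Longrightarrow> g \<in> G \<Longrightarrow> g \<in> Idl\<^bsub>ring_on S\<^esub> G"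
  using ring.genideal_self[OF ring_ring_on] by auto

lemma genideal_mult:
  assumes "G \<subseteq> S" "x \<in> S" "a \<in> Idl\<^bsub>ring_on S\<^esub> G"
  shows "x * a \<in> Idl\<^bsub>ring_on S\<^esub> G"
proof -
  have "ideal (Idl\<^bsub>ring_on S\<^esub> G) (ring_on S)"
    by (rule ring.genideal_ideal[OF ring_ring_on]) (use assms in auto)
  from ideal.I_l_closed[OF this assms(3), of x] assms(2) show ?thesis by simp
qed

lemma genideal_least:
  assumes "G \<subseteq> I" "I \<subseteq> S" "0 \<in> I" "\<And>a b. a \<in> I \<Longrightarrow> b \<in> I \<Longrightarrow> a + b \<in> I"
    and mult: "\<And>x a. x \<in> S \<Longrightarrow> a \<in> I \<Longrightarrow> x * a \<in> I"
  shows "Idl\<^bsub>ring_on S\<^esub> G \<subseteq> I"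
proof -
  interpret R: ring "ring_on S" by (rule ring_ring_on)
  have neg: "\<ominus>\<^bsub>ring_on S\<^esub> a \<in> I" if "a \<in> I" for a
  proof -
    have "- a \<in> I" using mult[OF uminus_mem[OF one_mem] that] by simp
    moreover have "\<ominus>\<^bsub>ring_on S\<^esub> a = - a"
      by (rule R.minus_equality) (use assms(2) that calculation in auto)
    ultimately show ?thesis by simp
  qed
  have mult': "a * x \<in> I" if "x \<in> S" "a \<in> I" for x a
    using mult[OF that] by (simp add: mult.commute)
  have "ideal I (ring_on S)"
    by (rule idealI[OF R.ring_axioms], rule R.add.subgroupI)
       (use assms mult' neg in \<open>auto simp: a_inv_def\<close>)
  then show ?thesis using assms(1) by (rule R.genideal_minimal)
qed

lemma genideal_mono:
  assumes "G \<subseteq> S" "F \<subseteq> Idl\<^bsub>ring_on S\<^esub> G"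
  shows "Idl\<^bsub>ring_on S\<^esub> F \<subseteq> Idl\<^bsub>ring_on S\<^esub> G"
  using ring.genideal_minimal[OF ring_ring_on ring.genideal_ideal[OF ring_ring_on, of G]] assms
  by auto

end

context valuation
begin

text \<open>
  If \<open>1 / x\<close> were in \<open>M\<close>, dividing the monic equation by the leading power of \<open>x\<close> would put \<open>-1\<close> into \<open>M\<close>.
\<close>
lemma integral_mem_B:
  assumes P: "P \<in> poly_over B" "Polynomial.lead_coeff P = 1" and root: "poly P x = 0"
  shows "x \<in> B"
proof (rule ccontr)
  assume x: "x \<notin> B"
  then have x0: "x \<noteq> 0" and M: "inverse x \<in> M" by (auto simp: B.zero_mem inverse_mem_M)
  define n where "n = Polynomial.degree P"
  define t where "t i = Polynomial.coeff P i * inverse x ^ (n - i)" for i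
  have "t i \<in> M" if "i < n" for i
  proof -
    have "inverse x ^ (n - i) = inverse x * inverse x ^ (n - i - 1)"
      using that by (metis Suc_diff_1 power_Suc zero_less_diff)
    also have "\<dots> \<in> M" by (intro M_mult M B.power_mem M_subset_B)
    finally show ?thesis using P(1) by (auto simp: t_def poly_over_def intro: M_mult')
  qed
  then have "sum t {..<n} \<in> M" by (intro M_sum) auto
  moreover have "sum t {..<n} + 1 = 0"
  proof -
    have "0 = poly P x * inverse x ^ n" using root by simp
    also have "\<dots> = sum t {..n}"
      unfolding poly_altdef n_def[symmetric] sum_distrib_right t_def
    proof (rule sum.cong)
      fix i assume "i \<in> {..n}"
      then have "inverse x ^ n = inverse x ^ i * inverse x ^ (n - i)" by (simp flip: power_add)
      then show "Polynomial.coeff P i * x ^ i * inverse x ^ n = Polynomial.coeff P i * inverse x ^ (n - i)"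
        using x0 by (simp add: field_simps)
    qed simp
    also have "{..n} = insert n {..<n}" by auto
    also have "sum t \<dots> = sum t {..<n} + 1" using P(2) by (simp add: t_def n_def)
    finally show ?thesis by simp
  qed
  ultimately have "- 1 \<in> M" by (simp add: eq_neg_iff_add_eq_0[symmetric])
  then show False using M_uminus[of "-1"] one_not_mem_M by simp
qed

end

context artin_schreier
begin

lemma norm_1: "field_norm K 1 = 1"
  by (simp add: field_norm_eq sigma_pow_fix K.one_mem)

lemma norm_inverse: "field_norm K (inverse x) = inverse (field_norm K x)"
proof (cases "x = 0")
  case False
  then have "field_norm K x * field_norm K (inverse x) = 1"
    using norm_mult[of x "inverse x"] norm_1 by simp
  then show ?thesis by (metis inverse_unique)
next
  case True
  have "field_norm K 0 = 0" by (subst norm_eq_0) (rule refl)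
  then show ?thesis by (simp only: True inverse_zero)
qed

lemma norm_shift_mem_AS_gens:
  assumes c: "c \<in> K"
  shows "field_norm K (\<alpha> - c) \<in> AS_gens p K"
proof -
  let ?E = "generate_field amb (K \<union> {x. x ^ p - x = field_norm K (\<alpha> - c)})"
  have E: "subfield ?E amb" by (rule generate_field_amb_subfield)
  then interpret E: unital_subring ?E by (simp add: subfield_amb_iff)
  have "K \<subseteq> ?E" by (auto intro: generate_field.incl)
  moreover have "\<alpha> - c \<in> ?E" by (rule generate_field.incl) (simp add: norm_shift[OF c])
  ultimately have "(\<alpha> - c) + c \<in> ?E" using c by (intro E.add_mem) auto
  then have "generate_field amb (K \<union> {\<alpha>}) \<subseteq> ?E"
    using \<open>K \<subseteq> ?E\<close> by (intro generate_field_amb_subset E) auto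
  then have "?E = UNIV" using generates by auto
  moreover have "\<alpha> - c \<noteq> 0" using alpha_not_mem c by auto
  ultimately show ?thesis by (simp add: AS_gens_def norm_mem)
qed

text \<open>
  For a root \<open>\<beta>\<close> of \<open>X ^ p - X - g\<close> outside \<open>K\<close>, the difference \<open>\<sigma> \<beta> - \<beta>\<close> is a nonzero element \<open>i\<close> of the
  prime field.  Then \<open>\<beta> / i\<close> is moved by \<open>\<sigma>\<close> exactly as \<open>\<alpha>\<close> is, so it is a shift of \<open>\<alpha>\<close>.
\<close>
lemma AS_gens_eq_norm_shift:
  assumes "g \<in> AS_gens p K"
  obtains c i where "c \<in> K" "of_nat i \<noteq> (0::'a)" "g = of_nat i * field_norm K (\<alpha> - c)"
proof -
  from assms have g: "g \<in> K" "generate_field amb (K \<union> {x. x ^ p - x = g}) = UNIV"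
    by (auto simp: AS_gens_def)
  have "\<exists>\<beta>. \<beta> \<notin> K \<and> \<beta> ^ p - \<beta> = g"
  proof (rule ccontr)
    assume "\<not> ?thesis"
    then have "generate_field amb (K \<union> {x. x ^ p - x = g}) \<subseteq> K"
      by (intro generate_field_amb_subset subfield_K) auto
    with g(2) alpha_not_mem show False by auto
  qed
  then obtain \<beta> where \<beta>: "\<beta> \<notin> K" "\<beta> ^ p - \<beta> = g" by blast
  have "\<sigma> \<beta> ^ p = \<sigma> (\<beta> + g)" using \<beta>(2) by (simp add: algebra_simps flip: sigma_power)
  then have "(\<sigma> \<beta> - \<beta>) ^ p = \<sigma> \<beta> - \<beta>"
    using \<beta>(2) g(1) by (simp add: frobenius_diff sigma_add sigma_fix algebra_simps)
  then obtain i where i: "\<sigma> \<beta> - \<beta> = of_nat i" using power_p_eq_self by blast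
  with \<beta>(1) fixed_mem have i0: "of_nat i \<noteq> (0::'a)" by auto
  define u where "u = inverse (of_nat i :: 'a)"
  define c where "c = \<alpha> - u * \<beta>"
  have uK: "u \<in> K" unfolding u_def by (intro K_inverse K.of_nat_mem)
  have up: "u ^ p = u" by (simp add: u_def power_inverse of_nat_power_p)
  have "\<sigma> \<beta> = \<beta> + of_nat i" using i by (simp add: algebra_simps)
  then have "\<sigma> (u * \<beta>) = u * (\<beta> + of_nat i)" by (simp add: sigma_mult sigma_fix[OF uK])
  also have "\<dots> = u * \<beta> + 1" using i0 by (simp add: u_def distrib_left)
  finally have s: "\<sigma> (u * \<beta>) = u * \<beta> + 1" .
  have "\<sigma> c + (u * \<beta> + 1) = \<alpha> + 1"
    using sigma_add[of c "u * \<beta>"] s by (simp add: c_def sigma_alpha)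
  then have "\<sigma> c = c" by (simp add: c_def eq_diff_eq)
  then have c: "c \<in> K" by (rule fixed_mem)
  have "field_norm K (\<alpha> - c) = u * g"
    unfolding norm_shift[OF c] by (simp add: c_def power_mult_distrib up \<beta>(2)[symmetric] algebra_simps)
  then have "g = of_nat i * field_norm K (\<alpha> - c)" using i0 by (simp add: u_def)
  with c i0 that show thesis by blast
qed

end

context artin_schreier_invariant
begin

abbreviation A where "A \<equiv> val_ring K v"

lemma mem_A: "x \<in> A \<longleftrightarrow> x \<in> K \<and> x \<in> B"
  by (auto simp: val_ring_def)

sublocale A: unital_subring A
  by standard (auto simp: mem_A intro: K.mem_intros B.mem_intros)

lemma sigma_pow_mem_B: "x \<in> B \<Longrightarrow> (\<sigma> ^^ n) x \<in> B"
  by (induction n) (auto intro: sigma_mem_B)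

text \<open>
  An element of \<open>B\<close> is a root of its characteristic polynomial, whose coefficients are integral because
  \<open>\<sigma>\<close> preserves \<open>B\<close>.
\<close>
lemma int_closure_eq: "int_closure A = B"
proof (intro equalityI subsetI)
  fix x assume "x \<in> int_closure A"
  then obtain P where "\<forall>i. Polynomial.coeff P i \<in> A" "Polynomial.lead_coeff P = 1" "poly P x = 0"
    by (auto simp: int_closure_def)
  then show "x \<in> B" by (intro integral_mem_B[of P]) (auto simp: poly_over_def mem_A)
next
  fix x assume x: "x \<in> B"
  define C where "C = (\<Prod>i<p. [:- (\<sigma> ^^ i) x, 1:])"
  have "C \<in> poly_over K" unfolding C_def by (rule char_poly_over_K)
  moreover have "C \<in> poly_over B"
    unfolding C_def using sigma_pow_mem_B[OF x]
    by (intro B.poly_over_prod B.poly_over_pCons B.poly_over_0 B.mem_intros)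
  ultimately have "\<forall>i. Polynomial.coeff C i \<in> A" by (simp add: poly_over_def mem_A)
  moreover have "Polynomial.lead_coeff C = 1"
    unfolding C_def by (subst Polynomial.lead_coeff_prod) simp
  moreover have "poly C x = 0"
    using p_pos by (auto simp: C_def poly_prod intro!: prod_zero bexI[of _ 0])
  ultimately show "x \<in> int_closure A" unfolding int_closure_def by blast
qed

lemma norm_mem_A: "x \<in> B \<Longrightarrow> field_norm K x \<in> A"
  unfolding mem_A by (auto simp: norm_mem) (auto simp: field_norm_eq intro!: B.prod_mem sigma_pow_mem_B)

lemma inverse_norm_shift_mem_A: "c \<in> K \<Longrightarrow> inverse (field_norm K (\<alpha> - c)) \<in> A"
  unfolding norm_inverse[symmetric] by (intro norm_mem_A inverse_shift_mem_B)

lemma inverse_of_nat_mem_A: "inverse (of_nat i) \<in> A"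
  unfolding mem_A by (intro conjI inverse_of_nat_mem_B K_inverse K.of_nat_mem)

lemma AS_gens_inverse_subset: "{1 / g | g. g \<in> AS_gens p K} \<subseteq> A"
proof -
  have "1 / g \<in> A" if "g \<in> AS_gens p K" for g
  proof -
    from that obtain c i where *: "c \<in> K" "g = of_nat i * field_norm K (\<alpha> - c)"
      by (rule AS_gens_eq_norm_shift)
    have "1 / g = inverse (of_nat i) * inverse (field_norm K (\<alpha> - c))"
      by (simp add: * divide_inverse)
    also have "\<dots> \<in> A" by (intro A.mult_mem inverse_of_nat_mem_A inverse_norm_shift_mem_A *)
    finally show ?thesis .
  qed
  then show ?thesis by blast
qed

lemma J_gens_subset: "{\<sigma> b / b - 1 | b. b \<noteq> 0} \<subseteq> B"
proof -
  have "\<sigma> b / b - 1 \<in> B" if "b \<noteq> 0" for b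
    using that by (intro B.diff_mem B.one_mem) (simp add: divide_mem_B v_sigma)
  then show ?thesis by blast
qed

lemma mult_shift_imp_mem_B:
  assumes "c \<in> K" "x * (\<alpha> - c) \<in> B"
  shows "x \<in> B"
proof -
  have "x = x * (\<alpha> - c) * inverse (\<alpha> - c)" using shift_nonzero[OF assms(1)] by simp
  also have "\<dots> \<in> B" by (intro B.mult_mem assms inverse_shift_mem_B)
  finally show ?thesis .
qed

lemma mult_shift_finer:
  assumes "x * (\<alpha> - c) \<in> B" "c \<in> K" "c' \<in> K" "v (\<alpha> - c) \<le> v (\<alpha> - c')"
  shows "x * (\<alpha> - c') \<in> B"
proof -
  have "x * (\<alpha> - c') = (x * (\<alpha> - c)) * ((\<alpha> - c') / (\<alpha> - c))"
    using shift_nonzero[OF assms(2)] by simp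
  also have "\<dots> \<in> B"
    using assms shift_nonzero by (intro B.mult_mem[OF assms(1)]) (simp add: divide_mem_B)
  finally show ?thesis .
qed

text \<open>
  The right-hand side is the union of the chain of fractional ideals \<open>(1 / (\<alpha> - c)) B\<close>, hence an ideal.
\<close>
lemma J_ideal_subset: "J_ideal A \<sigma> \<subseteq> {x. \<exists>c\<in>K. x * (\<alpha> - c) \<in> B}" (is "_ \<subseteq> ?I")
  unfolding J_ideal_def int_closure_eq
proof (rule B.genideal_least)
  show "{\<sigma> b / b - 1 | b. b \<noteq> 0} \<subseteq> ?I"
    using exists_shift_bounding_difference by blast
  show "?I \<subseteq> B"
  proof
    fix x assume "x \<in> ?I"
    then obtain c where c: "c \<in> K" "x * (\<alpha> - c) \<in> B" by blast
    show "x \<in> B" using c by (rule mult_shift_imp_mem_B)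
  qed
  show "0 \<in> ?I" using K.zero_mem B.zero_mem by auto
  fix x y
  show "x * y \<in> ?I" if xy: "x \<in> B" "y \<in> ?I"
  proof -
    from xy obtain c where c: "c \<in> K" "y * (\<alpha> - c) \<in> B" by blast
    have "x * y * (\<alpha> - c) \<in> B" using B.mult_mem[OF xy(1) c(2)] by (simp only: mult.assoc)
    with c(1) show ?thesis by blast
  qed
  show "x + y \<in> ?I" if xy: "x \<in> ?I" "y \<in> ?I"
  proof -
    from xy obtain c d where cd: "c \<in> K" "x * (\<alpha> - c) \<in> B" "d \<in> K" "y * (\<alpha> - d) \<in> B" by blast
    have "\<exists>e\<in>K. x * (\<alpha> - e) \<in> B \<and> y * (\<alpha> - e) \<in> B"
    proof (cases "v (\<alpha> - c) \<le> v (\<alpha> - d)")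
      case True
      then show ?thesis using mult_shift_finer[OF cd(2,1,3)] cd by blast
    next
      case False
      then have "v (\<alpha> - d) \<le> v (\<alpha> - c)" by simp
      then show ?thesis using mult_shift_finer[OF cd(4,3,1)] cd by blast
    qed
    then obtain e where e: "e \<in> K" "x * (\<alpha> - e) \<in> B" "y * (\<alpha> - e) \<in> B" by blast
    have "(x + y) * (\<alpha> - e) \<in> B" using B.add_mem[OF e(2,3)] by (simp only: distrib_right)
    with e(1) show ?thesis by blast
  qed
qed

lemma norm_J_ideal_subset: "field_norm K ` J_ideal A \<sigma> \<subseteq> A"
proof -
  have "x \<in> B" if "x \<in> J_ideal A \<sigma>" for x
  proof -
    from that J_ideal_subset obtain c where c: "c \<in> K" "x * (\<alpha> - c) \<in> B" by blast
    show "x \<in> B" using c by (rule mult_shift_imp_mem_B)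
  qed
  then show ?thesis using norm_mem_A by blast
qed

theorem H_ideal_eq_N_ideal: "H_ideal p K A = N_ideal K A \<sigma>"
proof
  show "N_ideal K A \<sigma> \<subseteq> H_ideal p K A"
    unfolding N_ideal_def H_ideal_def
  proof (rule A.genideal_mono[OF AS_gens_inverse_subset], rule subsetI)
    fix y assume "y \<in> field_norm K ` J_ideal A \<sigma>"
    then obtain x c where x: "y = field_norm K x" "c \<in> K" "x * (\<alpha> - c) \<in> B"
      using J_ideal_subset by blast
    have "1 / field_norm K (\<alpha> - c) \<in> {1 / g | g. g \<in> AS_gens p K}"
      using norm_shift_mem_AS_gens[OF x(2)] by blast
    then have "field_norm K (x * (\<alpha> - c)) * (1 / field_norm K (\<alpha> - c))
        \<in> Idl\<^bsub>ring_on A\<^esub> {1 / g | g. g \<in> AS_gens p K}"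
      by (intro A.genideal_mult A.genideal_incl AS_gens_inverse_subset norm_mem_A x(3))
    then show "y \<in> Idl\<^bsub>ring_on A\<^esub> {1 / g | g. g \<in> AS_gens p K}"
      using shift_nonzero[OF x(2)] by (simp add: norm_mult x(1))
  qed
  show "H_ideal p K A \<subseteq> N_ideal K A \<sigma>"
    unfolding N_ideal_def H_ideal_def
  proof (rule A.genideal_mono[OF norm_J_ideal_subset], rule subsetI)
    fix y assume "y \<in> {1 / g | g. g \<in> AS_gens p K}"
    then obtain g where g: "g \<in> AS_gens p K" "y = 1 / g" by blast
    from g(1) obtain c i where ci: "c \<in> K" "of_nat i \<noteq> (0::'a)" "g = of_nat i * field_norm K (\<alpha> - c)"
      by (rule AS_gens_eq_norm_shift)
    have "inverse (\<alpha> - c) = \<sigma> (\<alpha> - c) / (\<alpha> - c) - 1"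
      using shift_nonzero[OF ci(1)] by (simp add: sigma_shift[OF ci(1)] field_simps)
    then have "inverse (\<alpha> - c) \<in> {\<sigma> b / b - 1 | b. b \<noteq> 0}"
      using shift_nonzero[OF ci(1)] by blast
    then have "inverse (\<alpha> - c) \<in> J_ideal A \<sigma>"
      unfolding J_ideal_def int_closure_eq by (rule B.genideal_incl[OF J_gens_subset])
    then have "inverse (of_nat i) * field_norm K (inverse (\<alpha> - c))
        \<in> Idl\<^bsub>ring_on A\<^esub> (field_norm K ` J_ideal A \<sigma>)"
      by (intro A.genideal_mult A.genideal_incl norm_J_ideal_subset inverse_of_nat_mem_A imageI)
    then show "y \<in> Idl\<^bsub>ring_on A\<^esub> (field_norm K ` J_ideal A \<sigma>)"
      by (simp add: g(2) ci(3) norm_inverse divide_inverse)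
  qed
qed

end

theorem theorem1p3:
  fixes p :: nat
    and K A :: "'a::field set"
    and vK vL :: "'a \<Rightarrow> 'g::linordered_ab_group_add"
    and f \<alpha> :: 'a
    and \<sigma> :: "'a \<Rightarrow> 'a"
  assumes "p > 0" and "CHAR('a) = p"
    and "valuation_on K vK"
    and "A = val_ring K vK"
    and "henselian K vK"
    and "f \<in> K" and "f \<noteq> 0"
    and "\<alpha> ^ p - \<alpha> = f"
    and "generate_field amb (K \<union> {\<alpha>}) = UNIV"
    and "ring.dimension amb p K UNIV"
    and "valuation_on UNIV vL"
    and "\<And>x. x \<in> K - {0} \<Longrightarrow> vL x = vK x"
    and "\<sigma> \<in> gal K" and "\<sigma> \<alpha> = \<alpha> + 1"
    and "defectless p K vK vL \<or> rank_one K vK"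
  shows "H_ideal p K A = N_ideal K A \<sigma>"
proof -
  interpret artin_schreier_valued p K \<sigma> \<alpha> vL
  proof (intro artin_schreier_valued.intro artin_schreier.intro valuation.intro)
    show "subfield K amb" using assms(3) by (simp add: valuation_on_def)
    show "\<alpha> ^ p - \<alpha> \<in> K" using assms(6,8) by simp
  qed (fact assms)+
  have v_eq: "x = 0 \<or> vL x = vK x" if "x \<in> K" for x using assms(12)[of x] that by blast
  have "val_ring K vK = val_ring K vL" "val_max_ideal K vK = val_max_ideal K vL"
    unfolding val_ring_def val_max_ideal_def using v_eq by (metis (lifting))+
  with assms(4,5) have A: "A = val_ring K vL" and hensel: "henselian K vL"
    by (simp_all add: henselian_def)
  interpret artin_schreier_invariant p K \<sigma> \<alpha> vL
    by standard (rule henselian_imp_v_sigma[OF hensel])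
  show ?thesis unfolding A by (rule H_ideal_eq_N_ideal)
qed

end
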